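(* Let $\omega\approx 0.371859+0.519411i$ be the root of the polynomial $1-2z+2z^2-2z^5+2z^8$ with this approximate value. Then (1) $\omega\in\mathcal{M}$, $\omega\in\mathcal{M}_0$ and $\omega\in\mathcal{M}_1$; in fact $f\Lambda_\omega\cap g\Lambda_\omega=\{1/2\}$; (2) there are points of $\mathbb{D}^*\setminus\mathcal{M}$ arbitrarily close to $\omega$; (3) there are infinitely many rings of concentric closed loops contained in the interior of $\mathcal{M}$, each encircling $\omega$, which nest down to the point $\omega$. Consequently $\mathcal{M}$ has infinitely many holes, and these holes accumulate at $\omega$.
   Context: For $z\in\mathbb{D}^*=\{0<|z|<1\}$ let $f(x)=zx$, $g(x)=z(x-1)+1$, and let $\Lambda_z$ be the unique nonempty compact subset of $\mathbb{C}$ with $\Lambda_z=f(\Lambda_z)\cup g(\Lambda_z)$; write $f\Lambda_z=f(\Lambda_z)$, $g\Lambda_z=g(\Lambda_z)$. Define $\mathcal{M}=\{z\in\mathbb{D}^*:\Lambda_z\text{ connected}\}$, $\mathcal{M}_0=\{z\in\mathbb{D}^*:1/2\in\Lambda_z\}$, and $\mathcal{M}_1=\{z\in\mathbb{D}^*:\Lambda_z\text{ is connected and full}\}$, where a set is full if its complement in $\mathbb{C}$ is connected. One has $\mathcal{M}\subseteq\{|z|\ge 1/2\}$. A hole in $\mathcal{M}$ is a connected component of $\mathbb{D}^*\setminus\mathcal{M}$ other than the component containing $\{0<|z|<1/2\}$. *)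

theory Defs
  imports "HOL-Complex_Analysis.Complex_Analysis"
begin

definition punctured_disc :: "complex set" where
  "punctured_disc = {z. 0 < cmod z \<and> cmod z < 1}"

definition ifs_f :: "complex \<Rightarrow> complex \<Rightarrow> complex" where
  "ifs_f z x = z * x"

definition ifs_g :: "complex \<Rightarrow> complex \<Rightarrow> complex" where
  "ifs_g z x = z * (x - 1) + 1"

definition Lambda :: "complex \<Rightarrow> complex set" where
  "Lambda z = (THE K. compact K \<and> K \<noteq> {} \<and> K = ifs_f z ` K \<union> ifs_g z ` K)"

definition full :: "complex set \<Rightarrow> bool" where
  "full S \<longleftrightarrow> connected (- S)"

definition Mset :: "complex set" where
  "Mset = {z \<in> punctured_disc. connected (Lambda z)}"

definition M0 :: "complex set" where
  "M0 = {z \<in> punctured_disc. 1/2 \<in> Lambda z}"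

definition M1 :: "complex set" where
  "M1 = {z \<in> punctured_disc. connected (Lambda z) \<and> full (Lambda z)}"

definition hole :: "complex set \<Rightarrow> bool" where
  "hole H \<longleftrightarrow> H \<in> components (punctured_disc - Mset) \<and>
     \<not> {z. 0 < cmod z \<and> cmod z < 1/2} \<subseteq> H"

end

theory Submission
  imports Defs
begin

text \<open>Subtracting digit expansions, \<open>z\<close> lies in \<open>\<M>\<close> iff \<open>-1/z\<close> lies in the set \<open>\<Gamma>\<^sub>z\<close> of all sums
  \<open>\<Sum>c\<^sub>i z\<^sup>i\<close> with \<open>c\<^sub>i \<in> {-1, 0, 1}\<close>. For \<open>z\<close> near \<open>\<omega>\<close> the first seven digits of such an expansion
  of \<open>-1/z\<close> are forced, and then the digit 1 is forced as long as the tail stays close to \<open>1/(1 -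
  z)\<close>, from which it departs by a factor \<open>1/z\<close> per step. At \<open>\<omega>\<close> the tail never departs, so the
  expansion is unique with all digits nonzero, which gives \<open>f\<Lambda> \<inter> g\<Lambda> = {1/2}\<close>. For \<open>z = \<omega> + \<omega>\<^sup>k u /
  D\<close>, where \<open>D\<close> is the derivative at \<open>\<omega>\<close> of the initial deviation, the tail after \<open>k\<close> steps is
  close to \<open>1/(1 - \<omega>) - u\<close>. Hence \<open>\<M>\<close> near \<open>\<omega>\<close> is asymptotically a rescaled copy of \<open>\<Gamma>\<^sub>\<omega>\<close> near
  \<open>1/(1 - \<omega>)\<close>: a point \<open>u\<close> with \<open>1/(1 - \<omega>) - u \<notin> \<Gamma>\<^sub>\<omega>\<close> yields parameters in the complement of \<open>\<M>\<close>
  converging to \<open>\<omega>\<close>, and a circle around \<open>1/(1 - \<omega>)\<close> that stays robustly inside \<open>\<Gamma>\<^sub>z\<close> yields the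
  loops. Both facts about \<open>\<Gamma>\<^sub>z\<close> are finite computations in disc arithmetic; for the second, a
  rectangle is contained in \<open>\<Gamma>\<^sub>z\<close> if each of its points is led back into it by a bounded number of
  maps \<open>t \<mapsto> (t - d) / z\<close> with \<open>d \<in> {-1, 0, 1}\<close>.\<close>

subsection \<open>Digit expansions\<close>

definition digit_expansion :: "'a::real_normed_field set \<Rightarrow> 'a \<Rightarrow> (nat \<Rightarrow> 'a) \<Rightarrow> 'a \<Rightarrow> bool" where
  "digit_expansion D z c t \<longleftrightarrow> (\<forall>i. c i \<in> D) \<and> (\<lambda>i. c i * z ^ i) sums t"

definition digit_sums :: "'a::real_normed_field set \<Rightarrow> 'a \<Rightarrow> 'a set" where
  "digit_sums D z = {t. \<exists>c. digit_expansion D z c t}"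

lemma digit_expansion_Suc_iff:
  assumes "z \<noteq> 0"
  shows "digit_expansion D z c t \<longleftrightarrow>
    c 0 \<in> D \<and> digit_expansion D z (\<lambda>i. c (Suc i)) ((t - c 0) / z)"
proof -
  have "(\<lambda>i. c i * z ^ i) sums t \<longleftrightarrow> (\<lambda>i. c (Suc i) * z ^ Suc i) sums (t - c 0)"
    using sums_Suc_iff[of "\<lambda>i. c i * z ^ i" "t - c 0"] by simp
  also have "\<dots> \<longleftrightarrow> (\<lambda>i. z * (c (Suc i) * z ^ i)) sums (z * ((t - c 0) / z))"
    using assms by (simp add: mult_ac)
  also have "\<dots> \<longleftrightarrow> (\<lambda>i. c (Suc i) * z ^ i) sums ((t - c 0) / z)"
    by (rule sums_mult_iff[OF assms])
  finally have "(\<lambda>i. c i * z ^ i) sums t \<longleftrightarrow> (\<lambda>i. c (Suc i) * z ^ i) sums ((t - c 0) / z)" .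
  moreover have "(\<forall>i. c i \<in> D) \<longleftrightarrow> c 0 \<in> D \<and> (\<forall>i. c (Suc i) \<in> D)"
    by (metis not0_implies_Suc)
  ultimately show ?thesis by (simp add: digit_expansion_def)
qed

lemma mem_digit_sums_iff:
  assumes "z \<noteq> 0"
  shows "t \<in> digit_sums D z \<longleftrightarrow> (\<exists>d\<in>D. (t - d) / z \<in> digit_sums D z)"
proof
  assume "t \<in> digit_sums D z"
  then obtain c where "digit_expansion D z c t" by (auto simp: digit_sums_def)
  then have "c 0 \<in> D" "digit_expansion D z (\<lambda>i. c (Suc i)) ((t - c 0) / z)"
    using digit_expansion_Suc_iff[OF assms] by blast+
  then show "\<exists>d\<in>D. (t - d) / z \<in> digit_sums D z" by (auto simp: digit_sums_def)
next
  assume "\<exists>d\<in>D. (t - d) / z \<in> digit_sums D z"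
  then obtain d c where "d \<in> D" "digit_expansion D z c ((t - d) / z)"
    by (auto simp: digit_sums_def)
  then have "digit_expansion D z (case_nat d c) t"
    by (simp add: digit_expansion_Suc_iff[OF assms, of D "case_nat d c"])
  then show "t \<in> digit_sums D z" by (auto simp: digit_sums_def)
qed

lemma mem_image_affine_iff:
  fixes z :: "'a::field"
  assumes "z \<noteq> 0"
  shows "t \<in> (\<lambda>s. d + z * s) ` K \<longleftrightarrow> (t - d) / z \<in> K"
proof
  assume "(t - d) / z \<in> K"
  moreover have "t = d + z * ((t - d) / z)" using assms by simp
  ultimately show "t \<in> (\<lambda>s. d + z * s) ` K" by blast
qed (use assms in auto)

lemma digit_sums_eq_UN:
  assumes "z \<noteq> 0"
  shows "digit_sums D z = (\<Union>d\<in>D. (\<lambda>t. d + z * t) ` digit_sums D z)"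
  unfolding set_eq_iff UN_iff mem_image_affine_iff[OF assms]
  using mem_digit_sums_iff[OF assms] by blast

lemma bounded_power_mult_tendsto_zero:
  fixes z :: "'a::real_normed_field"
  assumes "norm z < 1" "bounded (range x)"
  shows "(\<lambda>n. z ^ n * x n) \<longlonglongrightarrow> 0"
proof -
  obtain B where "\<And>n. norm (x n) \<le> B" using assms(2) by (auto simp: bounded_iff)
  then show ?thesis
    using LIMSEQ_power_zero[OF assms(1)] by (intro lim_null_mult_right_bounded[where B = B]) auto
qed

lemma digit_sums_coinduct:
  assumes z: "z \<noteq> 0" "norm z < 1" and K: "bounded K"
    and step: "\<And>t. t \<in> K \<Longrightarrow> \<exists>d\<in>D. (t - d) / z \<in> K"
  shows "K \<subseteq> digit_sums D z"
proof
  fix t assume t: "t \<in> K"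
  obtain \<delta> where \<delta>: "\<And>s. s \<in> K \<Longrightarrow> \<delta> s \<in> D \<and> (s - \<delta> s) / z \<in> K"
    using step by metis
  define x where "x n = ((\<lambda>s. (s - \<delta> s) / z) ^^ n) t" for n
  have x_Suc: "x (Suc n) = (x n - \<delta> (x n)) / z" for n by (simp add: x_def)
  have x_in: "x n \<in> K" for n
    by (induction n) (use t \<delta> in \<open>simp_all add: x_def\<close>)
  have "(\<Sum>i<n. \<delta> (x i) * z ^ i) = t - z ^ n * x n" for n
  proof (induction n)
    case (Suc n)
    have "z ^ Suc n * x (Suc n) = z ^ n * x n - \<delta> (x n) * z ^ n"
      using z(1) by (simp add: x_Suc field_simps)
    then show ?case using Suc by (simp del: power_Suc)
  qed (simp add: x_def)
  moreover have "(\<lambda>n. t - z ^ n * x n) \<longlonglongrightarrow> t - 0"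
    using x_in by (intro tendsto_diff tendsto_const bounded_power_mult_tendsto_zero[OF z(2)]
        bounded_subset[OF K]) auto
  ultimately have "(\<lambda>i. \<delta> (x i) * z ^ i) sums t" by (simp add: sums_def)
  then have "digit_expansion D z (\<lambda>i. \<delta> (x i)) t"
    using \<delta> x_in by (simp add: digit_expansion_def)
  then show "t \<in> digit_sums D z" by (auto simp: digit_sums_def)
qed

lemma digit_sums_subset_closed:
  assumes "norm z < 1" and K: "closed K" "K \<noteq> {}"
    and step: "\<And>d t. d \<in> D \<Longrightarrow> t \<in> K \<Longrightarrow> d + z * t \<in> K"
  shows "digit_sums D z \<subseteq> K"
proof
  fix t assume "t \<in> digit_sums D z"
  then obtain c where c: "\<And>i. c i \<in> D" "(\<lambda>i. c i * z ^ i) sums t"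
    by (auto simp: digit_sums_def digit_expansion_def)
  obtain x where x: "x \<in> K" using K(2) by blast
  have "(\<Sum>i<n. c (i + k) * z ^ i) + z ^ n * x \<in> K" for n k
  proof (induction n arbitrary: k)
    case (Suc n)
    have "(\<Sum>i<Suc n. c (i + k) * z ^ i) + z ^ Suc n * x
        = c k + z * ((\<Sum>i<n. c (i + Suc k) * z ^ i) + z ^ n * x)"
      by (simp add: sum.lessThan_Suc_shift sum_distrib_left algebra_simps del: sum.lessThan_Suc)
    then show ?case by (simp only: step[OF c(1) Suc])
  qed (use x in simp)
  from this[where k = 0] have "(\<Sum>i<n. c i * z ^ i) + z ^ n * x \<in> K" for n by simp
  moreover have "(\<lambda>n. (\<Sum>i<n. c i * z ^ i) + z ^ n * x) \<longlonglongrightarrow> t + 0"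
    using c(2) bounded_power_mult_tendsto_zero[OF assms(1), of "\<lambda>_. x"]
    by (intro tendsto_add) (auto simp: sums_def)
  ultimately show "t \<in> K" unfolding add_0_right by (rule closed_sequentially[OF K(1)])
qed

lemma norm_digit_sums_le:
  fixes z :: "'a::real_normed_field"
  assumes "norm z < 1" and D: "\<And>d. d \<in> D \<Longrightarrow> norm d \<le> B" and "t \<in> digit_sums D z"
  shows "norm t \<le> B / (1 - norm z)"
proof -
  have "D \<noteq> {}" using assms(3) by (auto simp: digit_sums_def digit_expansion_def)
  then have "0 \<le> B" using D norm_ge_zero order_trans by blast
  then have "digit_sums D z \<subseteq> cball 0 (B / (1 - norm z))"
  proof (intro digit_sums_subset_closed[OF assms(1)])
    fix d t :: 'a assume "d \<in> D" and t: "t \<in> cball 0 (B / (1 - norm z))"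
    have "norm (d + z * t) \<le> B + norm z * (B / (1 - norm z))"
      using D[OF \<open>d \<in> D\<close>] t
      by (intro norm_triangle_mono)
        (simp_all only: norm_mult mult_left_mono mem_cball_0 norm_ge_zero)
    also have "\<dots> = B / (1 - norm z)" using assms(1) by (simp add: field_simps)
    finally show "d + z * t \<in> cball 0 (B / (1 - norm z))" by simp
  qed (use assms(1) \<open>0 \<le> B\<close> in \<open>simp_all add: field_simps\<close>)
  then show ?thesis using assms(3) by auto
qed

lemma compact_digit_sums:
  fixes z :: "'a::{real_normed_field, heine_borel}"
  assumes z: "z \<noteq> 0" "norm z < 1" and D: "finite D"
  shows "compact (digit_sums D z)"
proof -
  let ?S = "digit_sums D z"
  have "bounded D" using D by (rule finite_imp_bounded)
  then obtain B where "\<And>d. d \<in> D \<Longrightarrow> norm d \<le> B" by (auto simp: bounded_iff)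
  then have bounded_sums: "bounded ?S"
    using norm_digit_sums_le[OF z(2), of D B] by (auto simp: bounded_iff)
  have "compact (\<Union>d\<in>D. (\<lambda>t. d + z * t) ` closure ?S)"
    using D bounded_sums by (intro compact_UN compact_continuous_image continuous_intros)
      (auto simp: compact_closure)
  moreover have "?S \<subseteq> (\<Union>d\<in>D. (\<lambda>t. d + z * t) ` closure ?S)"
    by (subst digit_sums_eq_UN[OF z(1)]) (intro UN_mono image_mono closure_subset order_refl)
  ultimately have closure_subset_UN: "closure ?S \<subseteq> (\<Union>d\<in>D. (\<lambda>t. d + z * t) ` closure ?S)"
    by (rule closure_minimal[OF _ compact_imp_closed, rotated])
  have "\<exists>d\<in>D. (t - d) / z \<in> closure ?S" if "t \<in> closure ?S" for t
    using subsetD[OF closure_subset_UN that] by (simp only: UN_iff mem_image_affine_iff[OF z(1)])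
  then have "closure ?S \<subseteq> ?S"
    by (rule digit_sums_coinduct[OF z bounded_closure[OF bounded_sums]])
  then have "closed ?S" by (simp add: closure_subset_eq)
  then show ?thesis using bounded_sums by (simp add: compact_eq_bounded_closed)
qed

lemma digit_sums_unique:
  assumes z: "z \<noteq> 0" "norm z < 1" and K: "compact K" "K \<noteq> {}"
    and eq: "K = (\<Union>d\<in>D. (\<lambda>t. d + z * t) ` K)"
  shows "K = digit_sums D z"
proof
  show "K \<subseteq> digit_sums D z"
  proof (rule digit_sums_coinduct[OF z compact_imp_bounded[OF K(1)]])
    show "\<exists>d\<in>D. (t - d) / z \<in> K" if "t \<in> K" for t
      using that by (subst (asm) eq) (simp only: UN_iff mem_image_affine_iff[OF z(1)])
  qed
  show "digit_sums D z \<subseteq> K"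
    using eq by (intro digit_sums_subset_closed[OF z(2) compact_imp_closed[OF K(1)] K(2)]) blast
qed

lemma digit_sums_nonempty:
  assumes "norm z < 1" "D \<noteq> {}"
  shows "digit_sums D z \<noteq> {}"
proof -
  obtain d where "d \<in> D" using assms(2) by blast
  moreover have "(\<lambda>i. d * z ^ i) sums (d * (1 / (1 - z)))"
    using assms(1) by (intro sums_mult geometric_sums)
  ultimately show ?thesis by (auto simp: digit_sums_def digit_expansion_def)
qed

lemma digit_expansion_ex:
  fixes z :: "'a::{real_normed_field, banach}"
  assumes "norm z < 1" "bounded D" "\<And>i. c i \<in> D"
  obtains t where "digit_expansion D z c t"
proof -
  obtain B where B: "\<And>d. d \<in> D \<Longrightarrow> norm d \<le> B" using assms(2) by (auto simp: bounded_iff)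
  have "summable (\<lambda>i. B * norm z ^ i)"
    using assms(1) by (intro summable_mult summable_geometric) simp
  then have "summable (\<lambda>i. c i * z ^ i)"
    by (rule summable_comparison_test')
      (simp add: norm_mult norm_power mult_right_mono B assms(3))
  then show ?thesis using that assms(3) by (auto simp: digit_expansion_def summable_def)
qed

lemma digit_expansion_diff:
  assumes "digit_expansion D z c s" "digit_expansion E z b t"
  shows "digit_expansion {d - e |d e. d \<in> D \<and> e \<in> E} z (\<lambda>i. c i - b i) (s - t)"
  using assms sums_diff[of "\<lambda>i. c i * z ^ i" s "\<lambda>i. b i * z ^ i" t]
  by (auto simp: digit_expansion_def left_diff_distrib)

lemma mem_digit_sums_diff_iff:
  fixes z :: "'a::{real_normed_field, banach}"
  assumes "norm z < 1" "bounded E"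
  shows "u \<in> digit_sums {d - e |d e. d \<in> D \<and> e \<in> E} z \<longleftrightarrow>
    (\<exists>t\<in>digit_sums E z. u + t \<in> digit_sums D z)"
proof
  assume "u \<in> digit_sums {d - e |d e. d \<in> D \<and> e \<in> E} z"
  then obtain c where expansion_u: "\<And>i. c i \<in> {d - e |d e. d \<in> D \<and> e \<in> E}"
    "(\<lambda>i. c i * z ^ i) sums u"
    by (auto simp: digit_sums_def digit_expansion_def)
  have "\<exists>d e. d \<in> D \<and> e \<in> E \<and> c i = d - e" for i using expansion_u(1)[of i] by blast
  then obtain a b where digits_split: "\<And>i. a i \<in> D" "\<And>i. b i \<in> E" "\<And>i. c i = a i - b i" by metis
  obtain t where t: "digit_expansion E z b t"
    by (rule digit_expansion_ex[where c = b, OF assms digits_split(2)])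
  then have "(\<lambda>i. c i * z ^ i + b i * z ^ i) sums (u + t)"
    using expansion_u(2) by (intro sums_add) (simp_all add: digit_expansion_def)
  then have "digit_expansion D z a (u + t)"
    using digits_split by (simp add: digit_expansion_def left_diff_distrib)
  then show "\<exists>t\<in>digit_sums E z. u + t \<in> digit_sums D z"
    using t by (auto simp: digit_sums_def)
next
  assume "\<exists>t\<in>digit_sums E z. u + t \<in> digit_sums D z"
  then obtain t a b where "digit_expansion D z a (u + t)" "digit_expansion E z b t"
    by (auto simp: digit_sums_def)
  from digit_expansion_diff[OF this] show "u \<in> digit_sums {d - e |d e. d \<in> D \<and> e \<in> E} z"
    by (auto simp: digit_sums_def)
qed

lemma digit_expansion_mult:
  assumes "digit_expansion D z c t"
  shows "digit_expansion ((*) k ` D) z (\<lambda>i. k * c i) (k * t)"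
  using assms sums_mult[of "\<lambda>i. c i * z ^ i" t k]
  by (auto simp: digit_expansion_def mult.assoc)

lemma digit_sums_image_mult:
  assumes "k \<noteq> 0"
  shows "digit_sums ((*) k ` D) z = (*) k ` digit_sums D z"
proof (intro equalityI subsetI)
  fix t assume "t \<in> digit_sums ((*) k ` D) z"
  then obtain c where "digit_expansion ((*) k ` D) z c t" by (auto simp: digit_sums_def)
  from digit_expansion_mult[OF this, of "inverse k"] have "inverse k * t \<in> digit_sums D z"
    using assms by (auto simp: digit_sums_def image_image simp flip: mult.assoc)
  moreover have "t = k * (inverse k * t)" using assms by simp
  ultimately show "t \<in> (*) k ` digit_sums D z" by blast
qed (auto simp: digit_sums_def dest: digit_expansion_mult)

subsection \<open>Attractors of two contractions\<close>

locale ifs_attractor =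
  fixes f g :: "'a::heine_borel \<Rightarrow> 'a" and r :: real and K :: "'a set"
  assumes ratio: "0 < r" "r < 1"
    and lipschitz: "r-lipschitz_on UNIV f" "r-lipschitz_on UNIV g"
    and compact: "compact K" and nonempty: "K \<noteq> {}"
    and invariant: "K = f ` K \<union> g ` K"
begin

lemma images_subset: "f ` K \<subseteq> K" "g ` K \<subseteq> K"
  using invariant by blast+

lemma continuous_on_maps: "continuous_on S f" "continuous_on S g"
  using lipschitz by (meson continuous_on_subset lipschitz_on_continuous_on subset_UNIV)+

lemma ratio_power_mult_less:
  assumes "0 < e"
  obtains n where "r ^ n * B < e"
proof -
  have "(\<lambda>n. r ^ n * B) \<longlonglongrightarrow> 0 * B"
    using ratio by (intro tendsto_mult tendsto_const LIMSEQ_power_zero) auto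
  then have "\<forall>\<^sub>F n in sequentially. r ^ n * B < e"
    using assms by (intro order_tendstoD(2)[where y = 0]) auto
  then show ?thesis using that by (auto simp: eventually_sequentially)
qed

text \<open>When the two images of \<open>K\<close> meet, a separation of \<open>K\<close> with gap \<open>\<delta>\<close> pulls back along one of the
  contractions to a separation with gap \<open>\<delta> / r\<close>; iterating, the gap would outgrow the diameter.\<close>

definition separation :: "real \<Rightarrow> bool" where
  "separation \<delta> \<longleftrightarrow> (\<exists>A B. A \<union> B = K \<and> A \<noteq> {} \<and> B \<noteq> {} \<and> (\<forall>x\<in>A. \<forall>y\<in>B. \<delta> \<le> dist x y))"

lemma separation_le_diameter:
  assumes "separation \<delta>"
  shows "\<delta> \<le> diameter K"
proof -
  obtain x y where "x \<in> K" "y \<in> K" "\<delta> \<le> dist x y"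
    using assms by (auto simp: separation_def)
  then show ?thesis
    using diameter_bounded_bound[OF compact_imp_bounded[OF compact]] order_trans by blast
qed

lemma separation_pullback:
  assumes "r-lipschitz_on UNIV h" "h ` K \<subseteq> A \<union> B" "h ` K \<inter> A \<noteq> {}" "h ` K \<inter> B \<noteq> {}"
    and "\<And>x y. x \<in> A \<Longrightarrow> y \<in> B \<Longrightarrow> \<delta> \<le> dist x y"
  shows "separation (\<delta> / r)"
  unfolding separation_def
proof (intro exI conjI ballI)
  show "{x \<in> K. h x \<in> A} \<union> {x \<in> K. h x \<in> B} = K" using assms(2) by blast
  show "{x \<in> K. h x \<in> A} \<noteq> {}" "{x \<in> K. h x \<in> B} \<noteq> {}" using assms(3,4) by blast+
  fix x y assume "x \<in> {x \<in> K. h x \<in> A}" "y \<in> {x \<in> K. h x \<in> B}"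
  then have "\<delta> \<le> dist (h x) (h y)" using assms(5) by blast
  also have "\<dots> \<le> r * dist x y" using lipschitz_onD[OF assms(1)] by simp
  finally show "\<delta> / r \<le> dist x y" using ratio(1) by (simp add: divide_le_eq mult.commute)
qed

lemma separation_expand:
  assumes meet: "f ` K \<inter> g ` K \<noteq> {}" and "separation \<delta>" "0 < \<delta>"
  shows "separation (\<delta> / r)"
proof -
  obtain A B where parts: "A \<union> B = K" "A \<noteq> {}" "B \<noteq> {}"
    and \<delta>: "\<And>x y. x \<in> A \<Longrightarrow> y \<in> B \<Longrightarrow> \<delta> \<le> dist x y"
    using assms(2) by (auto simp: separation_def)
  have "A \<inter> B = {}" using \<delta> assms(3) by (metis disjoint_iff dist_self not_less)
  then have "\<not> f ` K \<union> g ` K \<subseteq> A" "\<not> f ` K \<union> g ` K \<subseteq> B"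
    unfolding invariant[symmetric] using parts by blast+
  moreover have "(F \<inter> A \<noteq> {} \<and> F \<inter> B \<noteq> {}) \<or> (G \<inter> A \<noteq> {} \<and> G \<inter> B \<noteq> {})"
    if "F \<subseteq> A \<union> B" "G \<subseteq> A \<union> B" "F \<inter> G \<noteq> {}" "\<not> F \<union> G \<subseteq> A" "\<not> F \<union> G \<subseteq> B" for F G
    using that by blast
  ultimately obtain h where h: "h = f \<or> h = g" "h ` K \<inter> A \<noteq> {}" "h ` K \<inter> B \<noteq> {}"
    using images_subset meet unfolding parts(1) by metis
  show ?thesis
  proof (rule separation_pullback[OF _ _ h(2,3) \<delta>])
    show "r-lipschitz_on UNIV h" using h(1) lipschitz by blast
    show "h ` K \<subseteq> A \<union> B" using h(1) images_subset unfolding parts(1) by blast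
  qed
qed

lemma connected_if_images_meet:
  assumes "f ` K \<inter> g ` K \<noteq> {}"
  shows "connected K"
proof (rule ccontr)
  assume "\<not> connected K"
  then obtain A B where parts: "closed A" "closed B" "A \<noteq> {}" "B \<noteq> {}" "A \<union> B = K" "A \<inter> B = {}"
    using connected_closed_set[OF compact_imp_closed[OF compact]] by blast
  have "compact A" using compact parts(1,5) by (metis closed_Int_compact inf_sup_absorb)
  then obtain \<delta> where \<delta>: "0 < \<delta>" "\<forall>x\<in>A. \<forall>y\<in>B. \<delta> \<le> dist x y"
    using separate_compact_closed[of A B] parts by blast
  then have "separation \<delta>" using parts by (auto simp: separation_def)
  then have separation_n: "separation (\<delta> / r ^ n)" for n
  proof (induction n)
    case (Suc n)
    have "0 < \<delta> / r ^ n" using \<delta>(1) ratio(1) by simp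
    from separation_expand[OF assms Suc.IH[OF Suc.prems] this] show ?case
      by (simp add: mult.commute)
  qed simp
  obtain n where "r ^ n * diameter K < \<delta>" using ratio_power_mult_less[OF \<delta>(1)] .
  then have "diameter K < \<delta> / r ^ n" using ratio(1) by (simp add: less_divide_eq mult.commute)
  then show False using separation_le_diameter[OF separation_n[of n]] by linarith
qed

lemma connected_iff: "connected K \<longleftrightarrow> f ` K \<inter> g ` K \<noteq> {}"
proof
  assume connected_K: "connected K"
  have closed: "closed (f ` K)" "closed (g ` K)"
    by (intro compact_imp_closed compact_continuous_image continuous_on_maps compact)+
  show "f ` K \<inter> g ` K \<noteq> {}"
  proof
    assume "f ` K \<inter> g ` K = {}"
    then have "f ` K \<inter> K = {} \<or> g ` K \<inter> K = {}"
      by (intro connected_closedD[OF connected_K _ _ closed] equalityD1[OF invariant]) blast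
    then show False using nonempty images_subset by blast
  qed
qed (rule connected_if_images_meet)

end

lemma connected_component_outside_cball:
  fixes S :: "'a::euclidean_space set"
  assumes "2 \<le> DIM('a)" "S \<subseteq> cball a e" "u \<notin> cball a e" "v \<notin> cball a e"
  shows "connected_component (- S) u v"
proof -
  have "connected (- cball a e)"
    using assms(1) by (intro connected_complement_bounded_convex) auto
  moreover have "u \<in> - cball a e" "v \<in> - cball a e" using assms(3,4) by auto
  ultimately show ?thesis
    using assms(2) unfolding connected_component_def by (meson Compl_anti_mono)
qed

locale planar_ifs_attractor = ifs_attractor f g r K
  for f g :: "complex \<Rightarrow> complex" and r K +
  assumes inj: "inj f" "inj g"
begin

text \<open>If two points off \<open>K\<close> were separated by \<open>K\<close>, then by Janiszewski's theorem they would be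
  separated by \<open>f ` K\<close> or by \<open>g ` K\<close>, and inductively by arbitrarily small copies of \<open>K\<close>.\<close>

lemma separating_copy:
  assumes meet: "connected (f ` K \<inter> g ` K)" and sep: "\<not> connected_component (- K) u v"
  shows "\<exists>h. inj h \<and> (r ^ n)-lipschitz_on UNIV h \<and> h ` K \<subseteq> K \<and>
    \<not> connected_component (- h ` K) u v"
proof (induction n)
  case 0
  have "1-lipschitz_on UNIV (id :: complex \<Rightarrow> complex)" by (simp add: lipschitz_on_def)
  then show ?case using sep by (intro exI[of _ id]) auto
next
  case (Suc n)
  then obtain h where h: "inj h" "(r ^ n)-lipschitz_on UNIV h" "h ` K \<subseteq> K"
    "\<not> connected_component (- h ` K) u v" by blast
  have cont: "continuous_on S h" for S
    using lipschitz_on_continuous_on[OF h(2)] continuous_on_subset by blast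
  have split: "h ` K = h ` f ` K \<union> h ` g ` K" by (subst invariant) (rule image_Un)
  have "connected (h ` f ` K \<inter> h ` g ` K)"
    unfolding image_Int[OF h(1), symmetric] by (rule connected_continuous_image[OF cont meet])
  moreover have "compact (h ` f ` K)" "closed (h ` g ` K)"
    by (intro compact_imp_closed compact_continuous_image cont continuous_on_maps compact)+
  ultimately have "\<not> connected_component (- h ` f ` K) u v \<or>
      \<not> connected_component (- h ` g ` K) u v"
    using Janiszewski[of "h ` f ` K" "h ` g ` K" u v] h(4) unfolding split by blast
  then obtain k where k: "k = f \<or> k = g" "\<not> connected_component (- h ` k ` K) u v" by blast
  have "r-lipschitz_on UNIV k" using k(1) lipschitz by blast
  from lipschitz_on_compose[OF this lipschitz_on_subset[OF h(2)]]
  have "(r ^ Suc n)-lipschitz_on UNIV (h \<circ> k)" by (simp add: mult.commute)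
  moreover have "inj (h \<circ> k)" using k(1) h(1) inj inj_compose by blast
  moreover have "(h \<circ> k) ` K \<subseteq> K"
    using k(1) h(3) split by (auto simp: image_comp[symmetric])
  ultimately show ?case
    using k(2) unfolding image_comp by blast
qed

lemma connected_complement:
  assumes "connected (f ` K \<inter> g ` K)"
  shows "connected (- K)"
  unfolding connected_iff_connected_component
proof (intro ballI, rule ccontr)
  fix u v assume outside: "u \<in> - K" "v \<in> - K" and sep: "\<not> connected_component (- K) u v"
  define e where "e = min (setdist {u} K) (setdist {v} K)"
  have "0 < e"
    using outside nonempty compact_imp_closed[OF compact]
      setdist_gt_0_compact_closed[of "{u}" K] setdist_gt_0_compact_closed[of "{v}" K]
    by (simp add: e_def)
  then obtain n where n: "r ^ n * diameter K < e" by (rule ratio_power_mult_less)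
  obtain h where h: "(r ^ n)-lipschitz_on UNIV h" "h ` K \<subseteq> K"
    "\<not> connected_component (- h ` K) u v"
    using separating_copy[OF assms sep] by blast
  obtain x where x: "x \<in> K" using nonempty by blast
  have "dist (h x) (h y) \<le> r ^ n * diameter K" if "y \<in> K" for y
  proof -
    have "dist (h x) (h y) \<le> r ^ n * dist x y" using lipschitz_onD[OF h(1)] by simp
    also have "\<dots> \<le> r ^ n * diameter K"
      using diameter_bounded_bound[OF compact_imp_bounded[OF compact] x that] ratio(1)
      by (intro mult_left_mono) auto
    finally show ?thesis .
  qed
  then have "h ` K \<subseteq> cball (h x) (r ^ n * diameter K)" by auto
  moreover have "e \<le> dist (h x) u" "e \<le> dist (h x) v"
    using h(2) x setdist_le_dist[of u "{u}" "h x" K] setdist_le_dist[of v "{v}" "h x" K]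
    by (auto simp: e_def dist_commute)
  ultimately have "connected_component (- h ` K) u v"
    using n by (intro connected_component_outside_cball) auto
  then show False using h(3) by blast
qed

end

lemma ifs_images_eq:
  "ifs_f z ` K \<union> ifs_g z ` K = (\<Union>d\<in>(*) (1 - z) ` {0, 1}. (\<lambda>t. d + z * t) ` K)"
proof -
  have "ifs_f z = (\<lambda>t. 0 + z * t)" "ifs_g z = (\<lambda>t. (1 - z) + z * t)"
    by (auto simp: ifs_f_def ifs_g_def algebra_simps)
  then show ?thesis by simp
qed

lemma Lambda_eq_digit_sums:
  assumes z: "z \<noteq> 0" "cmod z < 1"
  shows "Lambda z = digit_sums ((*) (1 - z) ` {0, 1}) z"
  unfolding Lambda_def ifs_images_eq
proof (rule the_equality)
  show "compact (digit_sums ((*) (1 - z) ` {0, 1}) z) \<and> digit_sums ((*) (1 - z) ` {0, 1}) z \<noteq> {} \<and>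
      digit_sums ((*) (1 - z) ` {0, 1}) z =
        (\<Union>d\<in>(*) (1 - z) ` {0, 1}. (\<lambda>t. d + z * t) ` digit_sums ((*) (1 - z) ` {0, 1}) z)"
    by (intro conjI compact_digit_sums digit_sums_nonempty digit_sums_eq_UN z) auto
qed (elim conjE, rule digit_sums_unique[OF z])

lemma Lambda_eq_image_digit_sums:
  assumes "z \<noteq> 0" "cmod z < 1"
  shows "Lambda z = (*) (1 - z) ` digit_sums {0, 1} z"
  unfolding Lambda_eq_digit_sums[OF assms] using assms(2) by (intro digit_sums_image_mult) auto

lemma planar_ifs_attractor_Lambda:
  assumes z: "z \<noteq> 0" "cmod z < 1"
  shows "planar_ifs_attractor (ifs_f z) (ifs_g z) (cmod z) (Lambda z)"
proof
  have "dist (ifs_f z x) (ifs_f z y) = cmod z * dist x y"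
    "dist (ifs_g z x) (ifs_g z y) = cmod z * dist x y" for x y
    by (simp_all add: ifs_f_def ifs_g_def dist_norm flip: norm_mult right_diff_distrib)
  then show "(cmod z)-lipschitz_on UNIV (ifs_f z)" "(cmod z)-lipschitz_on UNIV (ifs_g z)"
    by (simp_all add: lipschitz_on_def)
  show "compact (Lambda z)" "Lambda z \<noteq> {}"
    unfolding Lambda_eq_digit_sums[OF z] by (intro compact_digit_sums digit_sums_nonempty z; simp)+
  show "Lambda z = ifs_f z ` Lambda z \<union> ifs_g z ` Lambda z"
    unfolding ifs_images_eq Lambda_eq_digit_sums[OF z] by (rule digit_sums_eq_UN[OF z(1)])
  show "inj (ifs_f z)" "inj (ifs_g z)"
    using z(1) by (auto simp: inj_def ifs_f_def ifs_g_def)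
qed (use z in auto)

lemma mem_ifs_images_iff:
  assumes z: "z \<noteq> 0" "cmod z < 1"
  shows "x \<in> ifs_f z ` Lambda z \<inter> ifs_g z ` Lambda z \<longleftrightarrow>
    (\<exists>s\<in>digit_sums {0, 1} z. -1 / z + s \<in> digit_sums {0, 1} z \<and> x = z * (1 - z) * s)"
    (is "?lhs \<longleftrightarrow> ?rhs")
proof -
  have "1 - z \<noteq> 0" using z(2) by auto
  have ifs_g_eq_iff: "z * (1 - z) * s = ifs_g z ((1 - z) * t) \<longleftrightarrow> t = -1 / z + s" for s t
  proof -
    have "z * (1 - z) * s = ifs_g z ((1 - z) * t) \<longleftrightarrow> (1 - z) * (z * s) = (1 - z) * (1 + z * t)"
      by (simp add: ifs_g_def algebra_simps)
    also have "\<dots> \<longleftrightarrow> z * s = 1 + z * t"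
      unfolding mult_cancel_left using \<open>1 - z \<noteq> 0\<close> by blast
    also have "\<dots> \<longleftrightarrow> t = -1 / z + s"
      using z(1) by (auto simp: field_simps)
    finally show ?thesis .
  qed
  have "?lhs \<longleftrightarrow> (\<exists>s\<in>digit_sums {0, 1} z. \<exists>t\<in>digit_sums {0, 1} z.
      x = z * (1 - z) * s \<and> x = ifs_g z ((1 - z) * t))"
    unfolding Lambda_eq_image_digit_sums[OF z] by (auto simp: ifs_f_def mult.assoc)
  also have "\<dots> \<longleftrightarrow> ?rhs" by (intro bex_cong refl) (auto simp: ifs_g_eq_iff)
  finally show ?thesis .
qed

abbreviation difference_set :: "complex \<Rightarrow> complex set" where
  "difference_set z \<equiv> digit_sums {-1, 0, 1} z"

lemma differences_zero_one: "{d - e |d e. d \<in> {0, 1} \<and> e \<in> {0, 1}} = {-1, 0, 1 :: complex}"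
  by (auto simp: ex_disj_distrib conj_disj_distribL conj_disj_distribR)

lemma Mset_iff:
  "z \<in> Mset \<longleftrightarrow> z \<noteq> 0 \<and> cmod z < 1 \<and> -1 / z \<in> difference_set z"
proof (cases "z \<noteq> 0 \<and> cmod z < 1")
  case True
  then interpret planar_ifs_attractor "ifs_f z" "ifs_g z" "cmod z" "Lambda z"
    by (blast intro: planar_ifs_attractor_Lambda)
  have "-1 / z \<in> difference_set z \<longleftrightarrow>
      (\<exists>s\<in>digit_sums {0, 1} z. -1 / z + s \<in> digit_sums {0, 1} z)"
    using mem_digit_sums_diff_iff[of z "{0, 1}" "-1 / z" "{0, 1}", unfolded differences_zero_one]
      True by simp
  also have "\<dots> \<longleftrightarrow> connected (Lambda z)"
    unfolding connected_iff using mem_ifs_images_iff True by (simp add: ex_in_conv[symmetric]) blast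
  finally show ?thesis using True by (simp add: Mset_def punctured_disc_def)
qed (auto simp: Mset_def punctured_disc_def)

subsection \<open>Rescaling at a simple zero\<close>

lemma uniform_limit_shrinking_nbhd:
  fixes g :: "'a::real_normed_field \<Rightarrow> 'b::metric_space"
  assumes g: "isCont g a" and S: "bounded S" and h: "(h \<longlongrightarrow> 0) F"
  shows "uniform_limit S (\<lambda>n u. g (a + h n * u)) (\<lambda>u. g a) F"
proof (rule uniform_limitI)
  fix e :: real assume "0 < e"
  then obtain d where d: "0 < d" "\<And>z. dist z a < d \<Longrightarrow> dist (g z) (g a) < e"
    using g by (auto simp: continuous_at_eps_delta dist_commute)
  obtain B where B: "\<And>u. u \<in> S \<Longrightarrow> norm u \<le> B" using S by (auto simp: bounded_iff)
  have "((\<lambda>n. norm (h n) * B) \<longlongrightarrow> 0) F"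
    using h by (intro tendsto_mult_left_zero tendsto_norm_zero)
  then have "\<forall>\<^sub>F n in F. norm (h n) * B < d" using d(1) by (rule order_tendstoD(2))
  then show "\<forall>\<^sub>F n in F. \<forall>u\<in>S. dist (g (a + h n * u)) (g a) < e"
  proof eventually_elim
    case (elim n)
    have "norm (h n * u) \<le> norm (h n) * B" if "u \<in> S" for u
      unfolding norm_mult using B[OF that] by (rule mult_left_mono) simp
    then show ?case using elim by (intro ballI d(2)) (force simp: dist_norm)
  qed
qed

lemma uniform_limit_difference_quotient:
  fixes f :: "'a::real_normed_field \<Rightarrow> 'a"
  assumes deriv: "(f has_field_derivative D) (at a)" and S: "bounded S"
    and h: "(h \<longlongrightarrow> 0) F" "\<And>n. h n \<noteq> 0"
  shows "uniform_limit S (\<lambda>n u. (f (a + h n * u) - f a) / h n) (\<lambda>u. D * u) F"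
proof -
  obtain g where g: "\<And>z. f z - f a = g z * (z - a)" "isCont g a" "g a = D"
    using deriv unfolding CARAT_DERIV by blast
  have "uniform_limit S (\<lambda>n u. u) (\<lambda>u. u) F" by (rule uniform_limitI) simp
  then have "uniform_limit S (\<lambda>n u. g (a + h n * u) * u) (\<lambda>u. g a * u) F"
    using S by (intro uniform_lim_mult uniform_limit_shrinking_nbhd[OF g(2) S h(1)])
      (auto simp: bounded_iff)
  then show ?thesis by (simp add: g(1,3) h(2))
qed

lemma norm_one_plus_power_minus_one_le:
  fixes x :: "'a::{real_normed_field}"
  shows "norm ((1 + x) ^ n - 1) \<le> exp (real n * norm x) - 1"
proof -
  have "norm ((1 + x) ^ n - 1) \<le> (1 + norm x) ^ n - 1"
    using norm_prod_minus1_le_prod_minus1[of "\<lambda>_. x" "{..<n}"] by simp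
  also have "(1 + norm x) ^ n \<le> exp (norm x) ^ n"
    by (intro power_mono exp_ge_add_one_self) auto
  finally show ?thesis by (simp add: exp_of_nat_mult)
qed

lemma uniform_limit_one_plus_power:
  fixes e :: "nat \<Rightarrow> 'a::real_normed_field"
  assumes e: "(\<lambda>n. real n * norm (e n)) \<longlonglongrightarrow> 0" and S: "bounded S"
  shows "uniform_limit S (\<lambda>n u. (1 + e n * u) ^ n) (\<lambda>u. 1) sequentially"
proof (rule uniform_limitI)
  fix \<epsilon> :: real assume "0 < \<epsilon>"
  obtain B where B: "\<And>u. u \<in> S \<Longrightarrow> norm u \<le> B" using S by (auto simp: bounded_iff)
  have "(\<lambda>n. exp (real n * norm (e n) * B) - 1) \<longlonglongrightarrow> exp (0 * B) - 1"
    by (intro tendsto_intros e)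
  then have "\<forall>\<^sub>F n in sequentially. exp (real n * norm (e n) * B) - 1 < \<epsilon>"
    using \<open>0 < \<epsilon>\<close> by (intro order_tendstoD(2)[where y = 0]) simp_all
  then show "\<forall>\<^sub>F n in sequentially. \<forall>u\<in>S. dist ((1 + e n * u) ^ n) 1 < \<epsilon>"
  proof eventually_elim
    case (elim n)
    have "dist ((1 + e n * u) ^ n) 1 < \<epsilon>" if "u \<in> S" for u
    proof -
      have "dist ((1 + e n * u) ^ n) 1 \<le> exp (real n * norm (e n * u)) - 1"
        unfolding dist_norm by (rule norm_one_plus_power_minus_one_le)
      also have "real n * norm (e n * u) \<le> real n * norm (e n) * B"
        using B[OF that] by (simp add: norm_mult mult_left_mono mult.assoc)
      finally show ?thesis using elim by simp
    qed
    then show ?case by blast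
  qed
qed

lemma uniform_limit_rescaled:
  fixes f :: "'a::{real_normed_field, banach} \<Rightarrow> 'a"
  assumes f: "(f has_field_derivative D) (at a)" "f a = 0" "D \<noteq> 0"
    and a: "a \<noteq> 0" "norm a < 1" and S: "bounded S"
  shows "uniform_limit S (\<lambda>n u. f (a + a ^ n / D * u) / (a + a ^ n / D * u) ^ n) (\<lambda>u. u)
    sequentially"
proof -
  define h where "h n = a ^ n / D" for n
  have h_nonzero: "h n \<noteq> 0" for n using a(1) f(3) by (simp add: h_def)
  have "h \<longlonglongrightarrow> 0 / D"
    unfolding h_def using a(2) f(3) by (intro tendsto_divide tendsto_const LIMSEQ_power_zero) auto
  then have "uniform_limit S (\<lambda>n u. (f (a + h n * u) - f a) / h n) (\<lambda>u. D * u) sequentially"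
    using h_nonzero by (intro uniform_limit_difference_quotient[OF f(1) S]) auto
  then have numerator: "uniform_limit S (\<lambda>n u. f (a + h n * u) / h n) (\<lambda>u. D * u) sequentially"
    by (simp add: f(2))
  have "(\<lambda>n. real n * norm a ^ n * (1 / norm (D * a))) \<longlonglongrightarrow> 0 * (1 / norm (D * a))"
    using a(2) by (intro tendsto_mult tendsto_const powser_times_n_limit_0) simp
  moreover have "real n * norm (h n / a) = real n * norm a ^ n * (1 / norm (D * a))" for n
    by (simp add: h_def norm_divide norm_mult norm_power)
  ultimately have "uniform_limit S (\<lambda>n u. (1 + h n / a * u) ^ n) (\<lambda>u. 1) sequentially"
    using S by (intro uniform_limit_one_plus_power) simp_all
  then have "uniform_limit S (\<lambda>n u. D * (1 + h n / a * u) ^ n) (\<lambda>u. D * 1) sequentially"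
    by (intro uniform_lim_mult uniform_limit_const) (auto simp: bounded_iff)
  then have "uniform_limit S (\<lambda>n u. f (a + h n * u) / h n / (D * (1 + h n / a * u) ^ n))
      (\<lambda>u. D * u / (D * 1)) sequentially"
    using S f(3) by (intro uniform_lim_divide[OF numerator, where b = "norm D"])
      (auto intro: bounded_linear_image[OF _ bounded_linear_mult_right])
  moreover have "f (a + h n * u) / h n / (D * (1 + h n / a * u) ^ n)
      = f (a + h n * u) / (a + h n * u) ^ n"
    for n u
  proof -
    have "(a + h n * u) ^ n = a ^ n * (1 + h n / a * u) ^ n"
      using a(1) by (simp add: field_simps flip: power_mult_distrib)
    also have "a ^ n = h n * D" using f(3) by (simp add: h_def)
    finally show ?thesis by (simp add: mult.assoc)
  qed
  ultimately have "uniform_limit S (\<lambda>n u. f (a + h n * u) / (a + h n * u) ^ n) (\<lambda>u. D * u / (D * 1))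
      sequentially" by (simp only:)
  then show ?thesis using f(3) by (simp add: h_def)
qed

subsection \<open>Discs nesting down to a point\<close>

definition discs_nest_to :: "'a::metric_space \<Rightarrow> (nat \<Rightarrow> 'a) \<Rightarrow> (nat \<Rightarrow> real) \<Rightarrow> bool" where
  "discs_nest_to w a r \<longleftrightarrow>
     (\<forall>n. w \<in> ball (a n) (r n)) \<and>
     (\<forall>n. cball (a (Suc n)) (r (Suc n)) \<subseteq> ball (a n) (r n)) \<and>
     (\<forall>e>0. \<forall>\<^sub>F n in sequentially. cball (a n) (r n) \<subseteq> ball w e)"

lemma cball_scaled_subset:
  fixes w s m :: "'a::real_normed_field"
  shows "cball (w + s * m) (norm s * R) \<subseteq> cball w (norm s * (norm m + R))"
proof
  fix y assume "y \<in> cball (w + s * m) (norm s * R)"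
  then show "y \<in> cball w (norm s * (norm m + R))"
    using dist_triangle[of w y "w + s * m"] by (simp add: dist_norm norm_mult distrib_left)
qed

lemma ball_subset_scaled:
  fixes w s m :: "'a::real_normed_field"
  shows "ball w (norm s * (R - norm m)) \<subseteq> ball (w + s * m) (norm s * R)"
proof
  fix y assume "y \<in> ball w (norm s * (R - norm m))"
  then show "y \<in> ball (w + s * m) (norm s * R)"
    using dist_triangle[of "w + s * m" y w] by (simp add: dist_norm norm_mult right_diff_distrib)
qed

lemma discs_nest_to_geometric:
  fixes w c q m :: "'a::real_normed_field"
  assumes "c \<noteq> 0" "q \<noteq> 0" "norm q < 1" "norm m < R" "norm q * (norm m + R) < R - norm m"
  shows "discs_nest_to w (\<lambda>n. w + c * q ^ n * m) (\<lambda>n. norm (c * q ^ n) * R)"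
  unfolding discs_nest_to_def
proof (intro conjI allI impI)
  have pos: "0 < norm (c * q ^ n)" for n using assms(1,2) by simp
  show "w \<in> ball (w + c * q ^ n * m) (norm (c * q ^ n) * R)" for n
    using pos[of n] assms(4) by (intro subsetD[OF ball_subset_scaled]) simp
  have step: "norm (c * q ^ Suc n) * (norm m + R) < norm (c * q ^ n) * (R - norm m)" for n
  proof -
    have "norm (c * q ^ Suc n) * (norm m + R) = norm (c * q ^ n) * (norm q * (norm m + R))"
      by (simp add: norm_mult)
    then show ?thesis using mult_strict_left_mono[OF assms(5) pos[of n]] by (simp only:)
  qed
  have "cball w (norm (c * q ^ Suc n) * (norm m + R))
      \<subseteq> ball w (norm (c * q ^ n) * (R - norm m))" for n
    using step[of n] by (auto simp del: norm_mult power_Suc)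
  then show "cball (w + c * q ^ Suc n * m) (norm (c * q ^ Suc n) * R)
      \<subseteq> ball (w + c * q ^ n * m) (norm (c * q ^ n) * R)" for n
    using cball_scaled_subset ball_subset_scaled by (meson order_trans)
  fix e :: real assume "0 < e"
  have "(\<lambda>n. norm (c * q ^ n) * (norm m + R)) \<longlonglongrightarrow> norm (c * 0) * (norm m + R)"
    using assms(3) by (intro tendsto_intros LIMSEQ_power_zero)
  then have "\<forall>\<^sub>F n in sequentially. norm (c * q ^ n) * (norm m + R) < e"
    using \<open>0 < e\<close> by (intro order_tendstoD(2)[where y = 0]) simp_all
  then show "\<forall>\<^sub>F n in sequentially. cball (w + c * q ^ n * m) (norm (c * q ^ n) * R) \<subseteq> ball w e"
    by eventually_elim (use cball_scaled_subset in fastforce)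
qed

lemma discs_nest_to_similar:
  fixes w c q m :: "'a::real_normed_field"
  assumes "c \<noteq> 0" "q \<noteq> 0" "norm q < 1" "norm m < R"
  obtains p where "discs_nest_to w (\<lambda>n. w + c * q ^ (p * n) * m) (\<lambda>n. norm (c * q ^ (p * n)) * R)"
proof -
  have "(\<lambda>p. norm q ^ p * (norm m + R)) \<longlonglongrightarrow> 0 * (norm m + R)"
    using assms(3) by (intro tendsto_mult tendsto_const LIMSEQ_power_zero) simp
  then have "\<forall>\<^sub>F p in sequentially. norm q ^ p * (norm m + R) < R - norm m"
    using assms(4) by (intro order_tendstoD(2)[where y = 0]) auto
  then obtain p where p: "norm q ^ p * (norm m + R) < R - norm m"
    by (auto simp: eventually_sequentially)
  then have "0 < p" using norm_ge_zero[of m] by (cases "p = 0") auto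
  then have "norm (q ^ p) < 1" using assms(3) by (simp add: norm_power power_less_one_iff)
  then show ?thesis
    using discs_nest_to_geometric[of c "q ^ p" m R w] assms p
    by (intro that[of p]) (simp add: norm_power flip: power_mult)
qed

lemma sphere_subset_interior_scaled:
  fixes w s m :: "'a::real_normed_field"
  assumes "s \<noteq> 0" "0 < \<epsilon>" and mem: "\<And>u. \<bar>norm (u - m) - R\<bar> < \<epsilon> \<Longrightarrow> w + s * u \<in> M"
  shows "sphere (w + s * m) (norm s * R) \<subseteq> interior M"
proof -
  let ?A = "{z. \<bar>norm ((z - w) / s - m) - R\<bar> < \<epsilon>}"
  have "open ?A" using assms(1) by (intro open_Collect_less continuous_intros) auto
  moreover have "?A \<subseteq> M" using mem[of "(_ - w) / s"] assms(1) by auto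
  moreover have "sphere (w + s * m) (norm s * R) \<subseteq> ?A"
  proof
    fix z assume "z \<in> sphere (w + s * m) (norm s * R)"
    then have "norm (z - (w + s * m)) = norm s * R" by (simp add: dist_norm norm_minus_commute)
    moreover have "(z - w) / s - m = (z - (w + s * m)) / s"
      using assms(1) by (simp add: field_simps)
    ultimately show "z \<in> ?A" using assms(1,2) by (simp add: norm_divide)
  qed
  ultimately show ?thesis using interior_maximal by blast
qed

lemma circlepaths_if_discs_nest_to:
  assumes nest: "discs_nest_to w a r" and sub: "\<And>n. sphere (a n) (r n) \<subseteq> S"
  shows "\<exists>\<gamma>. (\<forall>n. simple_path (\<gamma> n) \<and> pathfinish (\<gamma> n) = pathstart (\<gamma> n) \<and> path_image (\<gamma> n) \<subseteq> S \<and>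
      w \<notin> path_image (\<gamma> n) \<and> winding_number (\<gamma> n) w \<noteq> 0 \<and>
      (\<forall>z \<in> path_image (\<gamma> (Suc n)). z \<notin> path_image (\<gamma> n) \<and> winding_number (\<gamma> n) z \<noteq> 0)) \<and>
    (\<forall>e>0. \<exists>N. \<forall>n\<ge>N. path_image (\<gamma> n) \<subseteq> ball w e)"
proof -
  define \<gamma> where "\<gamma> n = circlepath (a n) (r n)" for n
  have r_pos: "0 < r n" for n
    using nest zero_le_dist[of "a n" w] unfolding discs_nest_to_def mem_ball
    by (metis order_le_less_trans)
  have image: "path_image (\<gamma> n) = sphere (a n) (r n)" for n
    using r_pos[of n] by (simp add: \<gamma>_def path_image_circlepath_nonneg less_imp_le)
  have encircles: "z \<notin> path_image (\<gamma> n) \<and> winding_number (\<gamma> n) z \<noteq> 0"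
    if "z \<in> ball (a n) (r n)" for n z
    using that winding_number_circlepath[of z "a n" "r n"] unfolding image
    by (simp add: \<gamma>_def dist_norm norm_minus_commute)
  show ?thesis
  proof (intro exI[of _ \<gamma>] conjI allI impI ballI)
    fix n
    show "simple_path (\<gamma> n)" using r_pos[of n] by (simp add: \<gamma>_def simple_path_circlepath)
    show "pathfinish (\<gamma> n) = pathstart (\<gamma> n)" by (simp add: \<gamma>_def)
    show "path_image (\<gamma> n) \<subseteq> S" unfolding image by (rule sub)
    show "w \<notin> path_image (\<gamma> n)" "winding_number (\<gamma> n) w \<noteq> 0"
      using encircles nest unfolding discs_nest_to_def by blast+
    fix z assume "z \<in> path_image (\<gamma> (Suc n))"
    then have "z \<in> ball (a n) (r n)"
      using nest sphere_cball unfolding image discs_nest_to_def by blast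
    then show "z \<notin> path_image (\<gamma> n)" "winding_number (\<gamma> n) z \<noteq> 0" using encircles by blast+
  next
    fix e :: real assume "0 < e"
    then have "\<forall>\<^sub>F n in sequentially. cball (a n) (r n) \<subseteq> ball w e"
      using nest by (simp add: discs_nest_to_def)
    then show "\<exists>N. \<forall>n\<ge>N. path_image (\<gamma> n) \<subseteq> ball w e"
      unfolding eventually_sequentially image using sphere_cball by blast
  qed
qed

lemma connected_subset_ball:
  fixes C :: "'a::real_normed_vector set"
  assumes "connected C" "C \<inter> sphere a r = {}" "C \<inter> ball a r \<noteq> {}"
  shows "C \<subseteq> ball a r"
proof -
  have "0 < r" using assms(3) by (auto intro: le_less_trans[OF zero_le_dist])
  have "C - ball a r = {}"
    using connected_Int_frontier[OF assms(1,3)] assms(2)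
    unfolding frontier_ball[OF \<open>0 < r\<close>] by blast
  then show ?thesis by blast
qed

lemma component_subset_ball:
  fixes w :: "'a::real_normed_vector"
  assumes "w islimpt U" "w \<in> ball a r" "sphere a r \<inter> U = {}"
  obtains H where "H \<in> components U" "H \<subseteq> ball a r"
proof -
  obtain x where x: "x \<in> U" "x \<in> ball a r"
    using assms(1,2) unfolding islimpt_def by (metis open_ball)
  define H where "H = connected_component_set U x"
  have H: "H \<in> components U" "x \<in> H"
    using x(1) by (auto simp: H_def components_def connected_component_refl)
  have "H \<subseteq> ball a r"
    using in_components_connected[OF H(1)] in_components_subset[OF H(1)] H(2) x(2) assms(3)
    by (intro connected_subset_ball; blast)
  then show ?thesis using H(1) by (intro that)
qed

lemma eventually_not_mem_nested_disc:
  assumes "discs_nest_to w a r" "y \<noteq> w"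
  shows "\<forall>\<^sub>F n in sequentially. y \<notin> cball (a n) (r n)"
proof -
  have "\<forall>\<^sub>F n in sequentially. cball (a n) (r n) \<subseteq> ball w (dist w y)"
    using assms by (simp add: discs_nest_to_def)
  then show ?thesis by eventually_elim auto
qed

lemma infinite_components_if_discs_nest_to:
  fixes w :: "'a::real_normed_vector"
  assumes nest: "discs_nest_to w a r" and disjoint: "\<And>n. sphere (a n) (r n) \<inter> U = {}"
    and limit: "w islimpt U" "w \<notin> U" and "0 < e"
  shows "infinite {H \<in> components U. H \<subseteq> ball w e}"
proof
  let ?\<H> = "{H \<in> components U. H \<subseteq> ball w e}"
  assume "finite ?\<H>"
  moreover have "\<forall>\<^sub>F n in sequentially. \<not> H \<subseteq> ball (a n) (r n)" if "H \<in> ?\<H>" for H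
  proof -
    have "H \<in> components U" using that by simp
    then obtain y where "y \<in> H" "y \<noteq> w"
      using in_components_nonempty in_components_subset limit(2) by blast
    then show ?thesis
      using eventually_not_mem_nested_disc[OF nest \<open>y \<noteq> w\<close>] ball_subset_cball
      by (auto elim!: eventually_mono)
  qed
  ultimately have "\<forall>\<^sub>F n in sequentially. \<forall>H\<in>?\<H>. \<not> H \<subseteq> ball (a n) (r n)"
    by (intro eventually_ball_finite) auto
  moreover have "\<forall>\<^sub>F n in sequentially. cball (a n) (r n) \<subseteq> ball w e"
    using nest \<open>0 < e\<close> by (simp add: discs_nest_to_def)
  ultimately have "\<forall>\<^sub>F n in sequentially.
      (\<forall>H\<in>?\<H>. \<not> H \<subseteq> ball (a n) (r n)) \<and> cball (a n) (r n) \<subseteq> ball w e"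
    by (rule eventually_conj)
  then obtain n where n: "\<forall>H\<in>?\<H>. \<not> H \<subseteq> ball (a n) (r n)" "cball (a n) (r n) \<subseteq> ball w e"
    unfolding eventually_sequentially by blast
  have "w \<in> ball (a n) (r n)" using nest by (simp add: discs_nest_to_def)
  then obtain H where "H \<in> components U" "H \<subseteq> ball (a n) (r n)"
    using component_subset_ball[OF limit(1) _ disjoint] by blast
  then show False using n ball_subset_cball by blast
qed

subsection \<open>Disc arithmetic near the root\<close>

lemma cmod_le_iff: "0 \<le> r \<Longrightarrow> cmod z \<le> r \<longleftrightarrow> (Re z)\<^sup>2 + (Im z)\<^sup>2 \<le> r\<^sup>2"
  using power_mono_iff[of "cmod z" r 2] by (simp add: cmod_power2)

lemma le_cmod_iff: "0 \<le> r \<Longrightarrow> r \<le> cmod z \<longleftrightarrow> r\<^sup>2 \<le> (Re z)\<^sup>2 + (Im z)\<^sup>2"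
  using power_mono_iff[of r "cmod z" 2] by (simp add: cmod_power2)

lemma norm_inverse_diff_le:
  fixes x a v :: "'a::real_normed_field"
  assumes "0 < \<beta>" "\<beta> \<le> norm x" "norm (x - a) \<le> \<delta>" "norm (1 - a * v) \<le> \<epsilon>" "norm v \<le> V"
  shows "norm (1 / x - v) \<le> (\<epsilon> + \<delta> * V) / \<beta>"
proof -
  have "x \<noteq> 0" using assms(1,2) by auto
  have "norm ((x - a) * v) \<le> \<delta> * V"
    unfolding norm_mult using assms(3,5) order_trans[OF norm_ge_zero assms(3)]
    by (intro mult_mono) auto
  then have "norm (1 - a * v - (x - a) * v) \<le> \<epsilon> + \<delta> * V"
    using norm_triangle_ineq4[of "1 - a * v" "(x - a) * v"] assms(4) by linarith
  then have "norm ((1 - a * v - (x - a) * v) / x) \<le> (\<epsilon> + \<delta> * V) / \<beta>"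
    unfolding norm_divide using assms(1,2) by (intro frac_le order_trans[OF norm_ge_zero])
  then show ?thesis using \<open>x \<noteq> 0\<close> by (simp add: field_simps)
qed

definition near_root :: "complex \<Rightarrow> bool" where
  "near_root z \<longleftrightarrow> cmod (z - Complex 0.371859 0.519411) \<le> 0.00002"

lemma near_root_Re_Im:
  assumes "near_root z"
  shows "0.3718 \<le> Re z" "Re z \<le> 0.3719" "0.5193 \<le> Im z" "Im z \<le> 0.5195"
  using assms abs_Re_le_cmod[of "z - Complex 0.371859 0.519411"]
    abs_Im_le_cmod[of "z - Complex 0.371859 0.519411"]
  by (auto simp: near_root_def abs_le_iff)

lemma near_root_norm:
  assumes "near_root z"
  shows "0.6386 \<le> cmod z" "cmod z \<le> 0.64" "0.8 \<le> cmod (1 - z)"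
proof -
  note z = near_root_Re_Im[OF assms]
  have "0.3718\<^sup>2 \<le> (Re z)\<^sup>2" "(Re z)\<^sup>2 \<le> 0.3719\<^sup>2" "0.5193\<^sup>2 \<le> (Im z)\<^sup>2" "(Im z)\<^sup>2 \<le> 0.5195\<^sup>2"
    "0.6281\<^sup>2 \<le> (1 - Re z)\<^sup>2"
    using z by (auto intro!: power_mono)
  then show "0.6386 \<le> cmod z" "cmod z \<le> 0.64" "0.8 \<le> cmod (1 - z)"
    by (subst le_cmod_iff cmod_le_iff; simp add: power_divide)+
qed

lemma near_root_nontrivial:
  assumes "near_root z"
  shows "z \<noteq> 0" "cmod z < 1" "z \<noteq> 1"
  using near_root_norm[OF assms] by auto

text \<open>Discs are handled in fixed-point arithmetic with unit \<open>2\<^sup>-\<^sup>1\<^sup>6\<close>: \<open>(x, y, r)\<close> stands for the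
  closed disc of radius \<open>r / 2\<^sup>1\<^sup>6\<close> about \<open>(x + \<i> y) / 2\<^sup>1\<^sup>6\<close>.\<close>

definition fixed :: "int \<Rightarrow> real" where
  "fixed n = of_int n / 65536"

lemma fixed_le_iff: "fixed m \<le> fixed n \<longleftrightarrow> m \<le> n"
  by (simp add: fixed_def divide_le_cancel)

lemma fixed_add: "fixed (m + n) = fixed m + fixed n"
  by (simp add: fixed_def add_divide_distrib)

lemma fixed_minus: "fixed (- n) = - fixed n"
  by (simp add: fixed_def)

lemma fixed_abs: "fixed \<bar>n\<bar> = \<bar>fixed n\<bar>"
  by (simp add: fixed_def)

definition grid :: "int \<Rightarrow> int \<Rightarrow> complex" where
  "grid x y = Complex (fixed x) (fixed y)"

type_synonym int_disc = "int \<times> int \<times> int"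

definition disc :: "int_disc \<Rightarrow> complex set" where
  "disc = (\<lambda>(x, y, r). cball (grid x y) (fixed r))"

lemma mem_disc_iff: "t \<in> disc (x, y, r) \<longleftrightarrow> cmod (t - grid x y) \<le> fixed r"
  by (simp add: disc_def dist_norm norm_minus_commute)

lemma near_root_inverse:
  assumes "near_root z"
  shows "cmod (1 / z - grid 59721 (-83418)) \<le> 1 / 2 ^ 14" "cmod (1 / z) \<le> 1604 / 2 ^ 10"
proof -
  let ?a = "Complex 0.371859 0.519411" and ?v = "grid 59721 (-83418)"
  have "cmod (1 - ?a * ?v) \<le> 0.000002" "cmod ?v \<le> 1.5656"
    by (subst cmod_le_iff; simp add: grid_def fixed_def power2_eq_square)+
  then have "cmod (1 / z - ?v) \<le> (0.000002 + 0.00002 * 1.5656) / 0.6386"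
    using near_root_norm(1)[OF assms] assms
    by (intro norm_inverse_diff_le[where a = ?a]) (auto simp: near_root_def)
  then show "cmod (1 / z - ?v) \<le> 1 / 2 ^ 14" by simp
  show "cmod (1 / z) \<le> 1604 / 2 ^ 10"
    using near_root_norm(1)[OF assms] frac_le[of 1 1 "0.6386" "cmod z"] by (simp add: norm_divide)
qed

lemma near_root_fixed_point:
  assumes "near_root z"
  shows "1 / (1 - z) \<in> disc (61964, 51238, 3)"
proof -
  let ?a = "Complex 0.371859 0.519411" and ?v = "grid 61964 51238"
  have "cmod (1 - (1 - ?a) * ?v) \<le> 0.00001" "cmod ?v \<le> 1.23"
    by (subst cmod_le_iff; simp add: grid_def fixed_def power2_eq_square)+
  then have "cmod (1 / (1 - z) - ?v) \<le> (0.00001 + 0.00002 * 1.23) / 0.8"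
    using near_root_norm(3)[OF assms] assms
    by (intro norm_inverse_diff_le[where a = "1 - ?a"])
      (auto simp: near_root_def norm_minus_commute)
  then show ?thesis by (simp add: mem_disc_iff fixed_def)
qed

text \<open>\<open>disc_step\<close> encloses \<open>t \<mapsto> (t - d) / z\<close> for all \<open>z\<close> near \<open>\<omega>\<close>: \<open>59721 - 83418 \<i>\<close> is \<open>2\<^sup>1\<^sup>6 / z\<close>
  with error at most 4, \<open>1604 / 2\<^sup>1\<^sup>0\<close> bounds \<open>1 / \<bar>z\<bar>\<close>, and the final 4 pays for the roundings. The
  simplifier evaluates \<open>drop_bit\<close> much faster than \<open>div\<close>.\<close>

definition disc_step :: "int \<Rightarrow> int_disc \<Rightarrow> int_disc" where
  "disc_step d = (\<lambda>(x, y, r). let c = x - d * 65536 in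
     (drop_bit 16 (c * 59721 + y * 83418), drop_bit 16 (y * 59721 - c * 83418),
      drop_bit 10 (r * 1604) + drop_bit 14 (\<bar>c\<bar> + \<bar>y\<bar>) + 4))"

lemma drop_bit_bounds:
  "real_of_int (drop_bit n k) \<le> of_int k / 2 ^ n"
  "of_int k / 2 ^ n < real_of_int (drop_bit n k) + 1"
proof -
  have "drop_bit n k = \<lfloor>real_of_int k / 2 ^ n\<rfloor>"
    using floor_divide_of_int_eq[of k "2 ^ n", where 'a = real] by (simp add: drop_bit_eq_div)
  then show "real_of_int (drop_bit n k) \<le> of_int k / 2 ^ n"
    "of_int k / 2 ^ n < real_of_int (drop_bit n k) + 1"
    using floor_correct[of "real_of_int k / 2 ^ n"] by simp_all
qed

lemma grid_mult_rounding:
  "cmod (grid c y * grid a b -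
     grid (drop_bit 16 (c * a - y * b)) (drop_bit 16 (y * a + c * b))) \<le> fixed 2"
proof -
  let ?w = "grid c y * grid a b - grid (drop_bit 16 (c * a - y * b)) (drop_bit 16 (y * a + c * b))"
  have "\<bar>Re ?w\<bar> \<le> fixed 1" "\<bar>Im ?w\<bar> \<le> fixed 1"
    using drop_bit_bounds[where n = 16 and k = "c * a - y * b"]
      drop_bit_bounds[where n = 16 and k = "y * a + c * b"]
    by (simp_all add: grid_def fixed_def field_simps abs_le_iff)
  then show ?thesis using cmod_le[of ?w] by (simp add: fixed_def)
qed

lemma disc_step_sound:
  assumes z: "near_root z" and t: "t \<in> disc b"
  shows "(t - of_int d) / z \<in> disc (disc_step d b)"
proof -
  obtain x y r where b: "b = (x, y, r)" by (cases b)
  define c where "c = x - d * 65536"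
  let ?v = "grid 59721 (-83418)" and ?s = "t - of_int d"
  let ?n = "grid (drop_bit 16 (c * 59721 + y * 83418)) (drop_bit 16 (y * 59721 - c * 83418))"
  have "grid c y = grid x y - of_int d"
    by (simp add: grid_def fixed_def c_def complex_eq_iff field_simps)
  then have centre: "cmod (?s - grid c y) \<le> fixed r" using t by (simp add: b mem_disc_iff)
  have "cmod (grid c y) \<le> fixed (\<bar>c\<bar> + \<bar>y\<bar>)"
    using cmod_le[of "grid c y"] by (simp add: grid_def fixed_def add_divide_distrib)
  then have "cmod (grid c y * (1 / z - ?v)) \<le> fixed (\<bar>c\<bar> + \<bar>y\<bar>) * (1 / 2 ^ 14)"
    unfolding norm_mult using near_root_inverse(1)[OF z] by (intro mult_mono) (auto simp: fixed_def)
  moreover have "cmod ((?s - grid c y) * (1 / z)) \<le> fixed r * (1604 / 2 ^ 10)"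
    unfolding norm_mult using centre near_root_inverse(2)[OF z] order_trans[OF norm_ge_zero centre]
    by (intro mult_mono) auto
  moreover have "cmod (grid c y * ?v - ?n) \<le> fixed 2"
    using grid_mult_rounding[of c y 59721 "-83418"] by simp
  moreover have "?s / z - ?n
      = ((?s - grid c y) * (1 / z) + grid c y * (1 / z - ?v)) + (grid c y * ?v - ?n)"
    by (simp add: algebra_simps diff_divide_distrib)
  ultimately have "cmod (?s / z - ?n)
      \<le> fixed r * (1604 / 2 ^ 10) + fixed (\<bar>c\<bar> + \<bar>y\<bar>) * (1 / 2 ^ 14) + fixed 2"
    by (simp only:) (intro norm_triangle_mono)
  also have "\<dots> \<le> fixed (drop_bit 10 (r * 1604) + drop_bit 14 (\<bar>c\<bar> + \<bar>y\<bar>) + 4)"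
    using drop_bit_bounds(2)[where n = 10 and k = "r * 1604"]
      drop_bit_bounds(2)[where n = 14 and k = "\<bar>c\<bar> + \<bar>y\<bar>"]
    by (simp add: fixed_def field_simps)
  finally show ?thesis by (simp add: b disc_step_def c_def Let_def mem_disc_iff)
qed

definition digits :: "int list" where
  "digits = [1, 0, -1]"

lemma digits_eq: "{-1, 0, 1} = (of_int ` set digits :: 'a::ring_1 set)"
  by (auto simp: digits_def)

text \<open>The code equations below use conditionals because their evaluation is lazy: \<open>code_simp\<close>
  normalises both arguments of a conjunction or disjunction, but only one branch of a conditional.\<close>

lemma list_all_lazy [code]:
  "list_all P [] = True"
  "list_all P (x # xs) = (if P x then list_all P xs else False)"
  by simp_all

lemma list_ex_lazy [code]:
  "list_ex P [] = False"
  "list_ex P (x # xs) = (if P x then True else list_ex P xs)"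
  by simp_all

text \<open>\<open>183500 / 2\<^sup>1\<^sup>6\<close> exceeds \<open>1 / (1 - \<bar>z\<bar>)\<close>, which bounds the difference set.\<close>

definition outside_bound :: "int_disc \<Rightarrow> bool" where
  "outside_bound = (\<lambda>(x, y, r). (183500 + r) * (183500 + r) < x * x + y * y)"

lemma outside_bound_sound:
  assumes z: "near_root z" and t: "t \<in> disc b" and b: "outside_bound b"
  shows "t \<notin> difference_set z"
proof
  assume "t \<in> difference_set z"
  then have "cmod t \<le> 1 / (1 - cmod z)"
    using near_root_nontrivial(2)[OF z] by (intro norm_digit_sums_le) auto
  also have "\<dots> \<le> fixed 183500" using near_root_norm(2)[OF z] by (simp add: field_simps fixed_def)
  finally have norm_t: "cmod t \<le> fixed 183500" .
  obtain x y r where b_eq: "b = (x, y, r)" by (cases b)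
  have centre: "cmod (grid x y - t) \<le> fixed r"
    using t by (simp add: b_eq mem_disc_iff norm_minus_commute)
  then have "cmod (grid x y) \<le> fixed (183500 + r)"
    using norm_triangle_ineq[of "grid x y - t" t] norm_t by (simp add: fixed_def add_divide_distrib)
  then have "(cmod (grid x y))\<^sup>2 \<le> (fixed (183500 + r))\<^sup>2" by (rule power_mono) simp
  then have "real_of_int (x * x + y * y) \<le> of_int ((183500 + r) * (183500 + r))"
    unfolding cmod_power2 by (simp add: grid_def fixed_def power2_eq_square field_simps)
  then show False using b unfolding of_int_le_iff by (simp add: b_eq outside_bound_def)
qed

primrec escapes :: "nat \<Rightarrow> int_disc \<Rightarrow> bool" where
  "escapes 0 b \<longleftrightarrow> outside_bound b"
| "escapes (Suc n) b \<longleftrightarrow> outside_bound b \<or> list_all (\<lambda>d. escapes n (disc_step d b)) digits"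

lemma escapes_lazy [code]:
  "escapes 0 b = outside_bound b"
  "escapes (Suc n) b =
     (if outside_bound b then True else list_all (\<lambda>d. escapes n (disc_step d b)) digits)"
  by simp_all

lemma escapes_sound:
  assumes z: "near_root z" and "t \<in> disc b" "escapes n b"
  shows "t \<notin> difference_set z"
  using assms(2,3)
proof (induction n arbitrary: t b)
  case 0
  then show ?case using outside_bound_sound[OF z] by simp
next
  case (Suc n)
  show ?case
  proof (cases "outside_bound b")
    case False
    then have "(t - of_int d) / z \<notin> difference_set z" if "d \<in> set digits" for d
      using Suc.prems that
      by (intro Suc.IH[OF disc_step_sound[OF z]]) (auto simp: list_all_iff)
    then have "\<forall>d\<in>{-1, 0, 1}. (t - d) / z \<notin> difference_set z" by (simp add: digits_eq)
    then show ?thesis using mem_digit_sums_iff[OF near_root_nontrivial(1)[OF z]] by blast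
  qed (use outside_bound_sound[OF z] Suc.prems in blast)
qed

primrec forces :: "int list \<Rightarrow> int_disc \<Rightarrow> bool" where
  "forces [] b \<longleftrightarrow> True"
| "forces (d # w) b \<longleftrightarrow>
     list_all (\<lambda>e. escapes 20 (disc_step e b)) (remove1 d digits) \<and> forces w (disc_step d b)"

primrec digit_tail :: "complex \<Rightarrow> int list \<Rightarrow> complex \<Rightarrow> complex" where
  "digit_tail z [] t = t"
| "digit_tail z (d # w) t = digit_tail z w ((t - of_int d) / z)"

lemma forces_sound:
  assumes z: "near_root z" and "t \<in> disc b" "forces w b" "digit_expansion {-1, 0, 1} z c t"
  shows "(\<forall>i < length w. c i = of_int (w ! i)) \<and>
    digit_expansion {-1, 0, 1} z (\<lambda>i. c (i + length w)) (digit_tail z w t)"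
  using assms(2-)
proof (induction w arbitrary: t b c)
  case (Cons d w)
  have c_0: "c 0 \<in> {-1, 0, 1}"
    and shift: "digit_expansion {-1, 0, 1} z (\<lambda>i. c (Suc i)) ((t - c 0) / z)"
    using digit_expansion_Suc_iff[OF near_root_nontrivial(1)[OF z], THEN iffD1, OF Cons.prems(3)]
    by blast+
  obtain e where e: "e \<in> set digits" "c 0 = of_int e" using c_0 unfolding digits_eq by blast
  have "e = d"
  proof (rule ccontr)
    assume "e \<noteq> d"
    then have "escapes 20 (disc_step e b)" using Cons.prems(2) e(1) by (auto simp: list_all_iff)
    then have "(t - c 0) / z \<notin> difference_set z"
      unfolding e(2) by (rule escapes_sound[OF z disc_step_sound[OF z Cons.prems(1)]])
    then show False using shift by (auto simp: digit_sums_def)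
  qed
  then have "c 0 = of_int d" using e(2) by simp
  moreover from this have "(\<forall>i < length w. c (Suc i) = of_int (w ! i)) \<and>
      digit_expansion {-1, 0, 1} z (\<lambda>i. c (Suc (i + length w)))
        (digit_tail z w ((t - of_int d) / z))"
    using Cons.IH[OF disc_step_sound[OF z Cons.prems(1)], of d "\<lambda>i. c (Suc i)"] Cons.prems(2) shift
    by simp
  ultimately show ?case by (auto simp: nth_Cons split: nat.split)
qed simp

primrec returning :: "'a::field set \<Rightarrow> 'a \<Rightarrow> 'a set \<Rightarrow> nat \<Rightarrow> 'a set" where
  "returning D z K 0 = K"
| "returning D z K (Suc n) = K \<union> {t. \<exists>d\<in>D. (t - d) / z \<in> returning D z K n}"

lemma returning_subset_Suc: "returning D z K n \<subseteq> returning D z K (Suc n)"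
  by (induction n) auto

lemma bounded_returning:
  fixes z :: "'a::real_normed_field"
  assumes "z \<noteq> 0" "finite D" "bounded K"
  shows "bounded (returning D z K n)"
proof (induction n)
  case (Suc n)
  have "{t. \<exists>d\<in>D. (t - d) / z \<in> returning D z K n}
      = (\<Union>d\<in>D. (\<lambda>s. d + z * s) ` returning D z K n)"
    unfolding set_eq_iff UN_iff mem_Collect_eq mem_image_affine_iff[OF assms(1)] by blast
  moreover have "bounded ((\<lambda>s. d + z * s) ` returning D z K n)" for d
    using Suc bounded_linear_image[OF _ bounded_linear_mult_right, of _ z]
      bounded_translation[of "(*) z ` returning D z K n" d] by (simp add: image_image)
  ultimately show ?case using assms(2,3) by (simp add: bounded_UN)
qed (simp add: assms(3))

lemma returning_subset_digit_sums:
  fixes z :: "'a::real_normed_field"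
  assumes "z \<noteq> 0" "norm z < 1" "finite D" "bounded K"
    and return: "\<And>t. t \<in> K \<Longrightarrow> \<exists>d\<in>D. (t - d) / z \<in> returning D z K n"
  shows "returning D z K n \<subseteq> digit_sums D z"
proof (rule digit_sums_coinduct[OF assms(1,2) bounded_returning[OF assms(1,3,4)]])
  fix t assume t: "t \<in> returning D z K n"
  show "\<exists>d\<in>D. (t - d) / z \<in> returning D z K n"
  proof (cases "t \<in> K")
    case False
    then obtain m where "n = Suc m" using t by (cases n) auto
    then show ?thesis using t False returning_subset_Suc[of D z K m] by auto
  qed (rule return)
qed

lemma returning_uminus:
  assumes "\<And>d. d \<in> D \<Longrightarrow> - d \<in> D" "\<And>s. s \<in> K \<Longrightarrow> - s \<in> K"
    and "t \<in> returning D z K n"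
  shows "- t \<in> returning D z K n"
  using assms(3)
proof (induction n arbitrary: t)
  case (Suc n)
  have "(- t - - d) / z = - ((t - d) / z)" for d by (simp add: diff_divide_distrib)
  then show ?case using Suc assms(1,2) by fastforce
qed (use assms(2) in simp)

definition fits :: "int \<times> int \<Rightarrow> int_disc \<Rightarrow> bool" where
  "fits = (\<lambda>(a, b). \<lambda>(x, y, r). \<bar>x\<bar> + r \<le> a \<and> \<bar>y\<bar> + r \<le> b)"

definition rect :: "int \<times> int \<Rightarrow> complex set" where
  "rect = (\<lambda>(a, b). {t. \<bar>Re t\<bar> \<le> fixed a \<and> \<bar>Im t\<bar> \<le> fixed b})"

lemma fits_sound:
  assumes "fits T b" and t: "t \<in> disc b"
  shows "t \<in> rect T"
proof -
  obtain x y r where b: "b = (x, y, r)" by (cases b)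
  obtain p q where T: "T = (p, q)" by (cases T)
  have "\<bar>fixed x\<bar> + fixed r \<le> fixed p" "\<bar>fixed y\<bar> + fixed r \<le> fixed q"
    using assms(1) by (simp_all add: b T fits_def fixed_le_iff flip: fixed_abs fixed_add)
  moreover have "\<bar>Re t - fixed x\<bar> \<le> fixed r" "\<bar>Im t - fixed y\<bar> \<le> fixed r"
    using abs_Re_le_cmod[of "t - grid x y"] abs_Im_le_cmod[of "t - grid x y"] t
    by (simp_all add: b mem_disc_iff grid_def)
  ultimately have "\<bar>Re t\<bar> \<le> fixed p" "\<bar>Im t\<bar> \<le> fixed q" by linarith+
  then show ?thesis by (simp add: T rect_def)
qed

text \<open>Branches leaving the window \<open>W\<close> are abandoned; this only prunes the search.\<close>

primrec reaches :: "int \<times> int \<Rightarrow> int \<times> int \<Rightarrow> nat \<Rightarrow> int_disc \<Rightarrow> bool" where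
  "reaches T W 0 b \<longleftrightarrow> fits T b"
| "reaches T W (Suc n) b \<longleftrightarrow>
     fits T b \<or> fits W b \<and> list_ex (\<lambda>d. reaches T W n (disc_step d b)) digits"

lemma reaches_lazy [code]:
  "reaches T W 0 b = fits T b"
  "reaches T W (Suc n) b = (if fits T b then True
     else if fits W b then list_ex (\<lambda>d. reaches T W n (disc_step d b)) digits else False)"
  by simp_all

lemma reaches_sound:
  assumes z: "near_root z" and "t \<in> disc b" "reaches T W n b"
  shows "t \<in> returning {-1, 0, 1} z (rect T) n"
  using assms(2,3)
proof (induction n arbitrary: t b)
  case 0
  then show ?case using fits_sound by auto
next
  case (Suc n)
  show ?case
  proof (cases "fits T b")
    case False
    then obtain d where "d \<in> set digits" "reaches T W n (disc_step d b)"
      using Suc.prems(2) by (auto simp: list_ex_iff)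
    then have "(t - of_int d) / z \<in> returning {-1, 0, 1} z (rect T) n"
      using Suc.IH disc_step_sound[OF z Suc.prems(1)] by blast
    then show ?thesis using \<open>d \<in> set digits\<close> by (auto simp: digits_eq)
  qed (use fits_sound Suc.prems(1) in auto)
qed

definition square :: "int \<Rightarrow> int \<Rightarrow> int \<Rightarrow> complex set" where
  "square x y h = {t. \<bar>Re t - fixed x\<bar> \<le> fixed h \<and> \<bar>Im t - fixed y\<bar> \<le> fixed h}"

definition circumdisc :: "int \<Rightarrow> int \<Rightarrow> int \<Rightarrow> int_disc" where
  "circumdisc x y h = (x, y, h + drop_bit 1 h + 1)"

lemma square_subset_circumdisc: "square x y h \<subseteq> disc (circumdisc x y h)"
proof
  fix t assume t: "t \<in> square x y h"
  have "0 \<le> fixed h" using t by (auto simp: square_def)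
  have "(Re (t - grid x y))\<^sup>2 \<le> (fixed h)\<^sup>2" "(Im (t - grid x y))\<^sup>2 \<le> (fixed h)\<^sup>2"
    using t \<open>0 \<le> fixed h\<close> by (auto simp: square_def grid_def simp flip: abs_le_square_iff)
  moreover have "(fixed h)\<^sup>2 + (fixed h)\<^sup>2 \<le> (3 / 2 * fixed h)\<^sup>2"
    by (simp add: power_mult_distrib power_divide)
  ultimately have "cmod (t - grid x y) \<le> 3 / 2 * fixed h"
    using \<open>0 \<le> fixed h\<close> by (subst cmod_le_iff) auto
  also have "\<dots> \<le> fixed (h + drop_bit 1 h + 1)"
    using drop_bit_bounds(2)[where n = 1 and k = h] by (simp add: fixed_def field_simps)
  finally show "t \<in> disc (circumdisc x y h)" by (simp add: circumdisc_def mem_disc_iff)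
qed

primrec covered :: "(int_disc \<Rightarrow> bool) \<Rightarrow> nat \<Rightarrow> int \<Rightarrow> int \<Rightarrow> int \<Rightarrow> bool" where
  "covered P 0 x y h \<longleftrightarrow> P (circumdisc x y h)"
| "covered P (Suc n) x y h \<longleftrightarrow> P (circumdisc x y h) \<or> (let k = drop_bit 1 (h + 1) in
     list_all (\<lambda>(i, j). covered P n (x + i) (y + j) k) [(k, k), (k, - k), (- k, k), (- k, - k)])"

lemma covered_lazy [code]:
  "covered P 0 x y h = P (circumdisc x y h)"
  "covered P (Suc n) x y h =
     (if P (circumdisc x y h) then True else let k = drop_bit 1 (h + 1) in
       list_all (\<lambda>(i, j). covered P n (x + i) (y + j) k) [(k, k), (k, - k), (- k, k), (- k, - k)])"
  by simp_all

lemma mem_square_quarter: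
  fixes h
  defines "k \<equiv> drop_bit 1 (h + 1)"
  assumes "t \<in> square x y h"
  obtains i j where "(i, j) \<in> {(k, k), (k, - k), (- k, k), (- k, - k)}"
    "t \<in> square (x + i) (y + j) k"
proof -
  have "h \<le> 2 * k" unfolding k_def by (simp add: drop_bit_eq_div)
  then have h: "fixed h \<le> fixed k + fixed k" by (simp add: fixed_le_iff flip: fixed_add)
  have halve: "\<exists>i\<in>{k, - k}. \<bar>s - fixed (u + i)\<bar> \<le> fixed k" if "\<bar>s - fixed u\<bar> \<le> fixed h" for s u
  proof (cases "fixed u \<le> s")
    case True
    then have "\<bar>s - fixed (u + k)\<bar> \<le> fixed k" using that h unfolding fixed_add by linarith
    then show ?thesis by blast
  next
    case False
    then have "\<bar>s - fixed (u + - k)\<bar> \<le> fixed k"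
      using that h unfolding fixed_add fixed_minus by linarith
    then show ?thesis by blast
  qed
  have "\<bar>Re t - fixed x\<bar> \<le> fixed h" "\<bar>Im t - fixed y\<bar> \<le> fixed h"
    using assms(2) by (simp_all add: square_def)
  from this[THEN halve] obtain i j where "i \<in> {k, - k}" "\<bar>Re t - fixed (x + i)\<bar> \<le> fixed k"
    "j \<in> {k, - k}" "\<bar>Im t - fixed (y + j)\<bar> \<le> fixed k" by blast
  then show ?thesis by (intro that[of i j]) (blast, simp add: square_def)
qed

lemma covered_sound:
  assumes "covered P n x y h" "t \<in> square x y h"
  shows "\<exists>b. P b \<and> t \<in> disc b"
  using assms
proof (induction n arbitrary: x y h)
  case 0
  then show ?case unfolding covered.simps using square_subset_circumdisc by blast
next
  case (Suc n)
  show ?case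
  proof (cases "P (circumdisc x y h)")
    case False
    define k where "k = drop_bit 1 (h + 1)"
    obtain i j where ij: "(i, j) \<in> {(k, k), (k, - k), (- k, k), (- k, - k)}"
      "t \<in> square (x + i) (y + j) k"
      unfolding k_def by (rule mem_square_quarter[OF Suc.prems(2)])
    have "list_all (\<lambda>(i, j). covered P n (x + i) (y + j) k)
        [(k, k), (k, - k), (- k, k), (- k, - k)]"
      using False Suc.prems(1) unfolding covered.simps Let_def k_def by blast
    then have "covered P n (x + i) (y + j) k" using ij(1) by auto
    then show ?thesis using ij(2) by (rule Suc.IH)
  qed (use square_subset_circumdisc Suc.prems(2) in blast)
qed

definition avoids_annulus :: "int \<times> int \<Rightarrow> int \<Rightarrow> int \<Rightarrow> int_disc \<Rightarrow> bool" where
  "avoids_annulus = (\<lambda>(a, c) \<rho> \<sigma> (x, y, r). let q = (x - a) * (x - a) + (y - c) * (y - c) in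
     r < \<rho> \<and> q < (\<rho> - r) * (\<rho> - r) \<or> (\<sigma> + r) * (\<sigma> + r) < q)"

lemma avoids_annulus_sound:
  assumes avoids: "avoids_annulus (a, c) \<rho> \<sigma> b" and t: "t \<in> disc b"
  shows "cmod (t - grid a c) < fixed \<rho> \<or> fixed \<sigma> < cmod (t - grid a c)"
proof -
  obtain x y r where b: "b = (x, y, r)" by (cases b)
  define q where "q = (x - a) * (x - a) + (y - c) * (y - c)"
  let ?m = "cmod (grid x y - grid a c)"
  have centre: "cmod (t - grid x y) \<le> fixed r" using t by (simp add: b mem_disc_iff)
  have square_m: "(65536 * ?m)\<^sup>2 = of_int q"
    unfolding power_mult_distrib cmod_power2 q_def
    by (simp add: grid_def fixed_def power2_eq_square field_simps)
  consider "r < \<rho>" "q < (\<rho> - r)\<^sup>2" | "(\<sigma> + r)\<^sup>2 < q"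
    using avoids by (auto simp: b avoids_annulus_def q_def Let_def power2_eq_square)
  then show ?thesis
  proof cases
    case 1
    then have "(65536 * ?m)\<^sup>2 < of_int ((\<rho> - r)\<^sup>2)" unfolding square_m of_int_less_iff by blast
    then have "?m < fixed \<rho> - fixed r"
      using power2_less_imp_less[of "65536 * ?m" "real_of_int (\<rho> - r)"] 1(1)
      by (simp add: fixed_def field_simps)
    then show ?thesis
      using norm_triangle_ineq[of "t - grid x y" "grid x y - grid a c"] centre by simp
  next
    case 2
    then have "of_int ((\<sigma> + r)\<^sup>2) < (65536 * ?m)\<^sup>2" unfolding square_m of_int_less_iff .
    then have "fixed \<sigma> + fixed r < ?m"
      using power2_less_imp_less[of "real_of_int (\<sigma> + r)" "65536 * ?m"]
      by (simp add: fixed_def field_simps)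
    then show ?thesis
      using norm_triangle_ineq4[of "t - grid a c" "t - grid x y"] centre by simp
  qed
qed

subsection \<open>Regions inside and outside the difference set\<close>

text \<open>The disc of radius 32 units about \<open>gap_midpoint\<close> lies in the complement of the difference set,
  at distance about 0.087 from \<open>1/(1 - \<omega>)\<close>; the rectangle \<open>core\<close> and a thin annulus about
  \<open>ring_midpoint\<close> lie inside the difference set. All three were found by a computer search; circles
  centred at \<open>1/(1 - \<omega>)\<close> itself run into the complement.\<close>

abbreviation core :: "int \<times> int" where
  "core \<equiv> (85000, 34000)"

definition returns :: "int \<times> int \<Rightarrow> int_disc \<Rightarrow> bool" where
  "returns W b \<longleftrightarrow> list_ex (\<lambda>d. reaches core W 11 (disc_step d b)) digits"

abbreviation gap_midpoint :: complex where
  "gap_midpoint \<equiv> grid 61988 45548"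

abbreviation ring_midpoint :: complex where
  "ring_midpoint \<equiv> grid 49807 44761"

lemma escapes_gap: "escapes 20 (61988, 45548, 32)" by code_simp

abbreviation initial_digits :: "int list" where
  "initial_digits \<equiv> [-1, 1, 1, 1, -1, -1, -1]"

lemma forces_initial_digits: "forces initial_digits (-59721, 83418, 4)" by code_simp

lemma forces_one: "forces [1] (61964, 51238, 6500)" by code_simp

lemma core_returns:
  "list_all (\<lambda>x. covered (returns (100000, 68000)) 7 x 17000 17000)
     [-68000, -34000, 0, 34000, 68000]"
  by code_simp

lemma annulus_returns:
  "covered (\<lambda>b. if avoids_annulus (49807, 44761) 22380 22445 b then True
     else returns (131072, 86000) b) 9 49807 44761 22445"
  by code_simp

lemma returns_sound:
  assumes z: "near_root z" and "t \<in> disc b" "returns W b"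
  shows "\<exists>d\<in>{-1, 0, 1}. (t - d) / z \<in> returning {-1, 0, 1} z (rect core) 11"
proof -
  obtain d where "d \<in> set digits" "reaches core W 11 (disc_step d b)"
    using assms(3) by (auto simp: returns_def list_ex_iff)
  then have "(t - of_int d) / z \<in> returning {-1, 0, 1} z (rect core) 11"
    using reaches_sound[OF z disc_step_sound[OF z assms(2)]] by blast
  then show ?thesis using \<open>d \<in> set digits\<close> unfolding digits_eq by blast
qed

lemma upper_core_returning:
  assumes z: "near_root z" and t: "t \<in> rect core" "0 \<le> Im t"
  shows "\<exists>d\<in>{-1, 0, 1}. (t - d) / z \<in> returning {-1, 0, 1} z (rect core) 11"
proof -
  have "\<bar>Re t\<bar> \<le> fixed 85000" "\<bar>Im t\<bar> \<le> fixed 34000" using t(1) by (simp_all add: rect_def)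
  then have "\<bar>Im t - fixed 17000\<bar> \<le> fixed 17000" "- fixed 85000 \<le> Re t" "Re t \<le> fixed 85000"
    using t(2) unfolding fixed_def by linarith+
  moreover from this have "\<exists>x\<in>set [-68000, -34000, 0, 34000, 68000]. \<bar>Re t - fixed x\<bar> \<le> fixed 17000"
    unfolding fixed_def abs_le_iff list.set bex_simps by linarith
  ultimately have "\<exists>x\<in>set [-68000, -34000, 0, 34000, 68000]. t \<in> square x 17000 17000"
    by (simp add: square_def)
  then obtain b where "returns (100000, 68000) b" "t \<in> disc b"
    using core_returns covered_sound unfolding list_all_iff by blast
  then show ?thesis by (intro returns_sound[OF z])
qed

lemma core_returning:
  assumes z: "near_root z" and t: "t \<in> rect core"
  shows "\<exists>d\<in>{-1, 0, 1}. (t - d) / z \<in> returning {-1, 0, 1} z (rect core) 11"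
proof (cases "0 \<le> Im t")
  case False
  have rect_uminus: "- s \<in> rect core" if "s \<in> rect core" for s
    using that by (auto simp: rect_def)
  have "- t \<in> rect core" "0 \<le> Im (- t)" using rect_uminus t False by auto
  then obtain d where d: "d \<in> {-1, 0, 1}" "(- t - d) / z \<in> returning {-1, 0, 1} z (rect core) 11"
    using upper_core_returning[OF z] by blast
  then have "- ((- t - d) / z) \<in> returning {-1, 0, 1} z (rect core) 11"
    using rect_uminus by (intro returning_uminus) auto
  moreover have "- ((- t - d) / z) = (t - - d) / z" by (simp add: minus_divide_left)
  moreover have "- d \<in> {-1, 0, 1}" using d(1) by auto
  ultimately show ?thesis by metis
qed (rule upper_core_returning[OF z t])

lemma core_returning_subset:
  assumes z: "near_root z"
  shows "returning {-1, 0, 1} z (rect core) 11 \<subseteq> difference_set z"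
proof (rule returning_subset_digit_sums[OF near_root_nontrivial(1,2)[OF z]])
  have "rect core \<subseteq> cbox (Complex (-2) (-2)) (Complex 2 2)"
    by (auto simp: rect_def fixed_def in_cbox_complex_iff)
  then show "bounded (rect core)" using bounded_cbox bounded_subset by blast
qed (use core_returning[OF z] in auto)

lemma mem_difference_set_annulus:
  assumes z: "near_root z" and t: "fixed 22380 \<le> cmod (t - ring_midpoint)"
    "cmod (t - ring_midpoint) \<le> fixed 22445"
  shows "t \<in> difference_set z"
proof -
  have "t \<in> square 49807 44761 22445"
    using abs_Re_le_cmod[of "t - ring_midpoint"] abs_Im_le_cmod[of "t - ring_midpoint"] t(2)
    by (simp add: square_def grid_def)
  then obtain b where b: "t \<in> disc b"
    "if avoids_annulus (49807, 44761) 22380 22445 b then True else returns (131072, 86000) b"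
    using covered_sound[OF annulus_returns] by blast
  moreover have "\<not> avoids_annulus (49807, 44761) 22380 22445 b"
    using avoids_annulus_sound[OF _ b(1)] t by force
  ultimately have "returns (131072, 86000) b" by simp
  from returns_sound[OF z b(1) this] obtain d
    where "d \<in> {-1, 0, 1}" "(t - d) / z \<in> difference_set z"
    using core_returning_subset[OF z] by blast
  then show ?thesis using mem_digit_sums_iff[OF near_root_nontrivial(1)[OF z]] by blast
qed

subsection \<open>Tails of the expansions\<close>

lemma mem_digit_sums_if_digit_tail:
  assumes "z \<noteq> 0" "\<And>d. d \<in> set w \<Longrightarrow> of_int d \<in> D" "digit_tail z w t \<in> digit_sums D z"
  shows "t \<in> digit_sums D z"
  using assms(2,3)
proof (induction w arbitrary: t)
  case (Cons d w)
  then have "(t - of_int d) / z \<in> digit_sums D z" "of_int d \<in> D" by simp_all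
  then show ?case using mem_digit_sums_iff[OF assms(1)] by blast
qed simp

definition root_poly :: "complex \<Rightarrow> complex" where
  "root_poly z = 1 - 2*z + 2*z^2 - 2*z^5 + 2*z^8"

text \<open>After the digits \<open>initial_digits\<close> the remaining tail of \<open>-1/z\<close> is \<open>1 / (1 - z) - offset z\<close>;
  every further digit 1 divides the deviation from the fixed point \<open>1 / (1 - z)\<close> by \<open>z\<close>.\<close>

definition offset :: "complex \<Rightarrow> complex" where
  "offset z = root_poly z / ((1 - z) * z ^ 8)"

definition tail :: "nat \<Rightarrow> complex \<Rightarrow> complex" where
  "tail k z = 1 / (1 - z) - offset z / z ^ k"

lemma digit_tail_initial_digits:
  assumes "z \<noteq> 0" "z \<noteq> 1"
  shows "digit_tail z initial_digits (-1 / z) = tail 0 z"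
proof -
  define q where "q = 1 - z + z^2 + z^3 + z^4 - z^5 - z^6 - z^7"
  have "z ^ 8 * digit_tail z initial_digits (-1 / z) = - q"
    using assms(1) by (simp add: q_def field_simps power_numeral_even power_numeral_odd)
  then have "digit_tail z initial_digits (-1 / z) = - q / z ^ 8"
    using assms(1) by (simp add: field_simps)
  also have "\<dots> = ((1 - z) * - q) / ((1 - z) * z ^ 8)" using assms(2) by simp
  also have "(1 - z) * - q = z ^ 8 - root_poly z" unfolding q_def root_poly_def by algebra
  also have "(z ^ 8 - root_poly z) / ((1 - z) * z ^ 8) = tail 0 z"
    using assms by (simp add: tail_def offset_def diff_divide_distrib)
  finally show ?thesis .
qed

lemma tail_Suc:
  assumes "z \<noteq> 0" "z \<noteq> 1"
  shows "(tail k z - 1) / z = tail (Suc k) z"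
  using assms by (simp add: tail_def field_simps)

lemma mem_Mset_if_tail:
  assumes z: "near_root z" and tail: "tail k z \<in> difference_set z"
  shows "z \<in> Mset"
proof -
  note nontrivial = near_root_nontrivial[OF z]
  have "tail 0 z \<in> difference_set z"
    using tail
  proof (induction k)
    case (Suc k)
    then have "(tail k z - 1) / z \<in> difference_set z" using tail_Suc nontrivial by simp
    then have "tail k z \<in> difference_set z" using mem_digit_sums_iff[OF nontrivial(1)] by blast
    then show ?case by (rule Suc.IH)
  qed
  then have "-1 / z \<in> difference_set z"
    unfolding digit_tail_initial_digits[OF nontrivial(1,3), symmetric]
    by (rule mem_digit_sums_if_digit_tail[OF nontrivial(1), rotated]) auto
  then show ?thesis using nontrivial by (simp add: Mset_iff)
qed

lemma tail_mem_disc: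
  assumes z: "near_root z" and small: "cmod (offset z / z ^ k) \<le> fixed 6497"
  shows "tail k z \<in> disc (61964, 51238, 6500)"
proof -
  have "cmod (1 / (1 - z) - grid 61964 51238) \<le> fixed 3"
    using near_root_fixed_point[OF z] by (simp add: mem_disc_iff)
  then have "cmod (1 / (1 - z) - grid 61964 51238 - offset z / z ^ k) \<le> fixed 3 + fixed 6497"
    using norm_triangle_ineq4[of "1 / (1 - z) - grid 61964 51238" "offset z / z ^ k"] small
    by linarith
  then show ?thesis by (simp add: mem_disc_iff tail_def algebra_simps flip: fixed_add)
qed

lemma forced_expansion:
  assumes z: "near_root z" and c: "digit_expansion {-1, 0, 1} z c (-1 / z)"
    and small: "\<And>j. j < k \<Longrightarrow> cmod (offset z / z ^ j) \<le> fixed 6497"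
  shows "(\<forall>j < 7 + k. c j \<in> {-1, 1}) \<and>
    digit_expansion {-1, 0, 1} z (\<lambda>i. c (i + (7 + k))) (tail k z)"
  using small
proof (induction k)
  case 0
  have "- 1 / z - grid (-59721) 83418 = - (1 / z - grid 59721 (-83418))"
    by (simp add: grid_def fixed_def complex_eq_iff)
  then have "-1 / z \<in> disc (-59721, 83418, 4)"
    using near_root_inverse(1)[OF z]
    by (simp only: mem_disc_iff norm_minus_cancel) (simp add: fixed_def)
  moreover have "length initial_digits = 7" by simp
  ultimately have "\<forall>i<7. c i = of_int (initial_digits ! i)"
    "digit_expansion {-1, 0, 1} z (\<lambda>i. c (i + 7)) (tail 0 z)"
    using forces_sound[OF z _ forces_initial_digits c]
      digit_tail_initial_digits[OF near_root_nontrivial(1,3)[OF z]]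
    by metis+
  moreover have "initial_digits ! i \<in> {-1, 1}" if "i < 7" for i
    using nth_mem[of i initial_digits] that by auto
  ultimately show ?case by force
next
  case (Suc k)
  then have IH: "\<forall>j < 7 + k. c j \<in> {-1, 1}"
    "digit_expansion {-1, 0, 1} z (\<lambda>i. c (i + (7 + k))) (tail k z)" by simp_all
  from forces_sound[OF z tail_mem_disc[OF z Suc.prems] forces_one IH(2)]
  have c_next: "c (7 + k) = 1"
    and "digit_expansion {-1, 0, 1} z (\<lambda>i. c (i + (7 + Suc k))) (tail (Suc k) z)"
    using tail_Suc near_root_nontrivial[OF z] by (simp_all add: ac_simps)
  moreover have "c j \<in> {-1, 1}" if "j < 7 + Suc k" for j
    using that IH(1) c_next by (cases "j = 7 + k") auto
  ultimately show ?case by blast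
qed

lemma tail_mem_if_Mset:
  assumes z: "near_root z" "z \<in> Mset" and small: "cmod (offset z / z ^ k) \<le> fixed 6497"
  shows "tail k z \<in> difference_set z"
proof -
  note nontrivial = near_root_nontrivial[OF z(1)]
  obtain c where "digit_expansion {-1, 0, 1} z c (-1 / z)"
    using z(2) by (auto simp: Mset_iff digit_sums_def)
  moreover have "cmod (offset z / z ^ j) \<le> fixed 6497" if "j < k" for j
  proof -
    have "offset z / z ^ j = offset z / z ^ k * z ^ (k - j)"
      using nontrivial(1) that by (simp add: power_diff)
    then have "cmod (offset z / z ^ j) = cmod (offset z / z ^ k) * cmod z ^ (k - j)"
      by (simp only: norm_mult norm_power)
    also have "\<dots> \<le> cmod (offset z / z ^ k)"
      using nontrivial(2) by (intro mult_left_le power_le_one) auto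
    finally show ?thesis using small by linarith
  qed
  ultimately show ?thesis using forced_expansion[OF z(1)] by (auto simp: digit_sums_def)
qed

lemma complementary_digits:
  assumes z: "near_root z" "root_poly z = 0"
    and expansions: "digit_expansion {0, 1} z b (-1 / z + s)" "digit_expansion {0, 1} z a s"
  shows "b i + a i = 1"
proof -
  have "digit_expansion {-1, 0, 1} z (\<lambda>i. b i - a i) (-1 / z)"
    using digit_expansion_diff[OF expansions]
    by (simp only: differences_zero_one add_diff_cancel_right')
  from forced_expansion[OF z(1) this, of "Suc i"] have "b i - a i \<in> {-1, 1}"
    using z(2) by (simp add: offset_def fixed_def)
  moreover have "a i \<in> {0, 1}" "b i \<in> {0, 1}"
    using expansions unfolding digit_expansion_def by blast+
  ultimately show ?thesis by auto
qed

lemma mem_ifs_images_imp_half: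
  assumes z: "near_root z" "root_poly z = 0" and x: "x \<in> ifs_f z ` Lambda z \<inter> ifs_g z ` Lambda z"
  shows "x = 1/2"
proof -
  note nontrivial = near_root_nontrivial[OF z(1)]
  have "1 - z \<noteq> 0" using nontrivial(3) by simp
  obtain s a b where x_eq: "x = z * (1 - z) * s"
    and expansions: "digit_expansion {0, 1} z b (-1 / z + s)" "digit_expansion {0, 1} z a s"
    using x mem_ifs_images_iff[OF nontrivial(1,2)] by (auto simp: digit_sums_def)
  have "(\<lambda>i. b i * z ^ i + a i * z ^ i) sums (-1 / z + s + s)"
    using expansions by (intro sums_add) (simp_all add: digit_expansion_def)
  then have "(\<lambda>i. z ^ i) sums (-1 / z + s + s)"
    unfolding distrib_right[symmetric] complementary_digits[OF z expansions] by simp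
  then have "-1 / z + s + s = 1 / (1 - z)"
    using geometric_sums[OF nontrivial(2)] by (rule sums_unique2)
  then have "z * (1 - z) * (-1 / z + s + s) = z" using \<open>1 - z \<noteq> 0\<close> by simp
  moreover have "z * (1 - z) * (-1 / z + s + s) = 2 * x - (1 - z)"
    unfolding x_eq using nontrivial(1) by (simp add: field_simps)
  ultimately have "2 * x - (1 - z) = z" by (simp only:)
  then have "x * 2 = 1" by (simp add: diff_eq_eq mult.commute)
  then show ?thesis by (simp add: eq_divide_eq)
qed

lemma root_mem_Mset:
  assumes "near_root z" "root_poly z = 0"
  shows "z \<in> Mset"
proof (rule mem_Mset_if_tail[OF assms(1), of 0])
  have "digit_expansion {-1, 0, 1} z (\<lambda>i. 1) (1 / (1 - z))"
    using geometric_sums[OF near_root_nontrivial(2)[OF assms(1)]] by (simp add: digit_expansion_def)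
  then show "tail 0 z \<in> difference_set z"
    using assms(2) by (auto simp: tail_def offset_def digit_sums_def)
qed

lemma ifs_images_meet_half:
  assumes z: "near_root z" "root_poly z = 0"
  shows "ifs_f z ` Lambda z \<inter> ifs_g z ` Lambda z = {1/2}"
proof -
  interpret planar_ifs_attractor "ifs_f z" "ifs_g z" "cmod z" "Lambda z"
    by (rule planar_ifs_attractor_Lambda[OF near_root_nontrivial(1,2)[OF z(1)]])
  have "ifs_f z ` Lambda z \<inter> ifs_g z ` Lambda z \<noteq> {}"
    using root_mem_Mset[OF z] connected_iff by (simp add: Mset_def)
  moreover have "ifs_f z ` Lambda z \<inter> ifs_g z ` Lambda z \<subseteq> {1/2}"
    using mem_ifs_images_imp_half[OF z] by (intro subsetI) (simp only: singleton_iff)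
  ultimately show ?thesis unfolding subset_singleton_iff by argo
qed

lemma root_poly_deriv_nonzero:
  assumes "near_root z"
  shows "-2 + 4*z - 10*z^4 + 16*z^7 \<noteq> 0"
proof -
  note z = near_root_Re_Im[OF assms]
  have "0 \<le> Re z * Im z * ((Im z)\<^sup>2 - (Re z)\<^sup>2)"
    using z by (intro mult_nonneg_nonneg) (auto intro: power_mono)
  moreover have "Im (z ^ 4) = - 4 * (Re z * Im z * ((Im z)\<^sup>2 - (Re z)\<^sup>2))"
    by (simp add: power4_eq_xxxx power2_eq_square algebra_simps)
  moreover have "\<bar>Im (z ^ 7)\<bar> \<le> 0.64 ^ 7"
  proof -
    have "\<bar>Im (z ^ 7)\<bar> \<le> cmod z ^ 7" using abs_Im_le_cmod[of "z ^ 7"] by (simp add: norm_power)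
    also have "\<dots> \<le> 0.64 ^ 7" by (rule power_mono[OF near_root_norm(2)[OF assms]]) simp
    finally show ?thesis .
  qed
  ultimately have "0 < Im (-2 + 4*z - 10*z^4 + 16*z^7)"
    using z(3) by (simp add: power_divide)
  then show ?thesis by (metis less_irrefl zero_complex.sel(2))
qed

lemma offset_has_field_derivative:
  assumes z: "near_root z" "root_poly z = 0"
  shows "(offset has_field_derivative (-2 + 4*z - 10*z^4 + 16*z^7) / ((1 - z) * z ^ 8)) (at z)"
proof -
  have "(root_poly has_field_derivative (-2 + 4*z - 10*z^4 + 16*z^7)) (at z)"
    unfolding root_poly_def by (auto intro!: derivative_eq_intros)
  moreover have "((\<lambda>w. (1 - w) * w ^ 8) has_field_derivative 8 * (1 - z) * z ^ 7 - z ^ 8) (at z)"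
    by (auto intro!: derivative_eq_intros simp: algebra_simps)
  ultimately have "((\<lambda>w. root_poly w / ((1 - w) * w ^ 8)) has_field_derivative
      ((-2 + 4*z - 10*z^4 + 16*z^7) * ((1 - z) * z ^ 8) -
        root_poly z * (8 * (1 - z) * z ^ 7 - z ^ 8)) /
      (((1 - z) * z ^ 8) * ((1 - z) * z ^ 8))) (at z)"
    using near_root_nontrivial[OF z(1)] by (intro DERIV_divide) auto
  then show ?thesis
    using near_root_nontrivial[OF z(1)] z(2) by (simp add: offset_def[abs_def])
qed

lemma deriv_offset:
  assumes z: "near_root z" "root_poly z = 0"
  shows "(offset has_field_derivative deriv offset z) (at z)" "deriv offset z \<noteq> 0"
  using offset_has_field_derivative[OF z] root_poly_deriv_nonzero[OF z(1)]
    near_root_nontrivial[OF z(1)]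
  by (simp_all add: DERIV_imp_deriv)

subsection \<open>Rings and holes at the root\<close>

locale landmark_root =
  fixes \<omega> :: complex
  assumes root: "root_poly \<omega> = 0"
    and approx: "cmod (\<omega> - Complex 0.371859 0.519411) < 0.00001"
begin

lemma near_root_ball: "z \<in> ball \<omega> 0.00001 \<Longrightarrow> near_root z"
  using norm_triangle_ineq[of "z - \<omega>" "\<omega> - Complex 0.371859 0.519411"] approx
  by (simp add: near_root_def dist_norm norm_minus_commute)

lemma near_root: "near_root \<omega>"
  by (rule near_root_ball) simp

lemmas nontrivial = near_root_nontrivial[OF near_root]

definition rescale :: "nat \<Rightarrow> complex" where
  "rescale k = \<omega> ^ k / deriv offset \<omega>"

lemma rescale_eq: "rescale k = rescale 0 * \<omega> ^ k" and rescale_nonzero: "rescale k \<noteq> 0"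
  using deriv_offset[OF near_root root] nontrivial by (simp_all add: rescale_def)

lemma rescale_tendsto_zero: "rescale \<longlonglongrightarrow> 0"
proof -
  have "(\<lambda>k. rescale 0 * \<omega> ^ k) \<longlonglongrightarrow> rescale 0 * 0"
    using nontrivial(2) by (intro tendsto_mult tendsto_const LIMSEQ_power_zero)
  then show ?thesis by (simp flip: rescale_eq)
qed

lemma uniform_limit_offset:
  "uniform_limit (cball 0 1) (\<lambda>k u. offset (\<omega> + rescale k * u) / (\<omega> + rescale k * u) ^ k)
    (\<lambda>u. u) sequentially"
proof -
  have "offset \<omega> = 0" by (simp add: offset_def root)
  then show ?thesis
    unfolding rescale_def
    using deriv_offset[OF near_root root] nontrivial
    by (intro uniform_limit_rescaled) simp_all
qed

lemma uniform_limit_tail: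
  "uniform_limit (cball 0 1) (\<lambda>k u. tail k (\<omega> + rescale k * u)) (\<lambda>u. 1 / (1 - \<omega>) - u) sequentially"
  unfolding tail_def
  using nontrivial(3)
  by (intro uniform_limit_minus uniform_limit_offset uniform_limit_shrinking_nbhd
      rescale_tendsto_zero)
    (auto intro!: continuous_intros)

lemma eventually_near_root: "\<forall>\<^sub>F k in sequentially. \<forall>u\<in>cball 0 1. near_root (\<omega> + rescale k * u)"
proof -
  have "uniform_limit (cball 0 1) (\<lambda>k u. \<omega> + rescale k * u) (\<lambda>u. \<omega>) sequentially"
    by (intro uniform_limit_shrinking_nbhd[where g = "\<lambda>z. z"] rescale_tendsto_zero) auto
  then have "\<forall>\<^sub>F k in sequentially. \<forall>u\<in>cball 0 1. dist (\<omega> + rescale k * u) \<omega> < 0.00001"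
    by (rule uniform_limitD) simp
  then show ?thesis
    by eventually_elim (auto intro!: near_root_ball simp: dist_commute)
qed

lemma eventually_tail_near:
  assumes "0 < e"
  shows "\<forall>\<^sub>F k in sequentially. \<forall>u\<in>cball 0 1. near_root (\<omega> + rescale k * u) \<and>
    cmod (offset (\<omega> + rescale k * u) / (\<omega> + rescale k * u) ^ k - u) < e \<and>
    cmod (tail k (\<omega> + rescale k * u) - (1 / (1 - \<omega>) - u)) < e"
  using eventually_near_root uniform_limitD[OF uniform_limit_offset assms]
    uniform_limitD[OF uniform_limit_tail assms]
  by eventually_elim (simp add: dist_norm)

lemma cmod_fixed_point_diff_le:
  "cmod (1 / (1 - \<omega>) - grid x y) \<le> fixed 3 + cmod (grid (61964 - x) (51238 - y))"
proof -
  have "1 / (1 - \<omega>) - grid x y = (1 / (1 - \<omega>) - grid 61964 51238) + grid (61964 - x) (51238 - y)"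
    by (simp add: grid_def fixed_def complex_eq_iff diff_divide_distrib)
  moreover have "cmod (1 / (1 - \<omega>) - grid 61964 51238) \<le> fixed 3"
    using near_root_fixed_point[OF near_root] by (simp add: mem_disc_iff)
  ultimately show ?thesis by (metis norm_triangle_mono order_refl)
qed

definition gap :: complex where
  "gap = 1 / (1 - \<omega>) - gap_midpoint"

lemma cmod_gap_le: "cmod gap \<le> fixed 5694"
proof -
  have "cmod (grid (-24) 5690) \<le> fixed 5691"
    by (subst cmod_le_iff) (simp_all add: grid_def fixed_def power2_eq_square)
  then show ?thesis
    using cmod_fixed_point_diff_le[of 61988 45548] by (simp add: gap_def fixed_def)
qed

lemma eventually_gap_mem_exterior:
  "\<forall>\<^sub>F k in sequentially. \<omega> + rescale k * gap \<in> punctured_disc - Mset"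
proof -
  have "0 < fixed 32" by (simp add: fixed_def)
  from eventually_tail_near[OF this] show ?thesis
  proof eventually_elim
    case (elim k)
    define z where "z = \<omega> + rescale k * gap"
    have "gap \<in> cball 0 1" using cmod_gap_le by (simp add: fixed_def)
    moreover have "1 / (1 - \<omega>) - gap = gap_midpoint" by (simp add: gap_def)
    ultimately have z: "near_root z" "cmod (offset z / z ^ k - gap) < fixed 32"
      "cmod (tail k z - gap_midpoint) < fixed 32"
      using elim unfolding z_def by metis+
    have "cmod (offset z / z ^ k) \<le> fixed 6497"
      using norm_triangle_ineq[of "offset z / z ^ k - gap" gap] z(2) cmod_gap_le
      by (simp add: fixed_def)
    moreover have "tail k z \<notin> difference_set z"
      using z(3) by (intro escapes_sound[OF z(1) _ escapes_gap]) (simp add: mem_disc_iff)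
    ultimately have "z \<notin> Mset" using tail_mem_if_Mset[OF z(1)] by blast
    then show ?case using near_root_nontrivial[OF z(1)] by (simp add: z_def punctured_disc_def)
  qed
qed

lemma ifs_images_meet: "ifs_f \<omega> ` Lambda \<omega> \<inter> ifs_g \<omega> ` Lambda \<omega> = {1/2}"
  by (rule ifs_images_meet_half[OF near_root root])

sublocale planar_ifs_attractor "ifs_f \<omega>" "ifs_g \<omega>" "cmod \<omega>" "Lambda \<omega>"
  by (rule planar_ifs_attractor_Lambda[OF nontrivial(1,2)])

lemma mem_Mset: "\<omega> \<in> Mset"
  by (rule root_mem_Mset[OF near_root root])

lemma mem_M0: "\<omega> \<in> M0"
proof -
  have "1/2 \<in> Lambda \<omega>" using images_subset(1) ifs_images_meet by blast
  then show ?thesis using nontrivial by (simp add: M0_def punctured_disc_def)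
qed

lemma mem_M1: "\<omega> \<in> M1"
  using mem_Mset connected_complement ifs_images_meet by (simp add: M1_def Mset_def full_def)

lemma islimpt_exterior: "\<omega> islimpt (punctured_disc - Mset)"
  unfolding islimpt_approachable
proof (intro allI impI)
  fix e :: real assume "0 < e"
  have "(\<lambda>k. \<omega> + rescale k * gap) \<longlonglongrightarrow> \<omega> + 0 * gap"
    by (intro tendsto_intros rescale_tendsto_zero)
  then have "\<forall>\<^sub>F k in sequentially. dist (\<omega> + rescale k * gap) \<omega> < e"
    using \<open>0 < e\<close> by (simp add: tendsto_iff)
  then have "\<forall>\<^sub>F k in sequentially.
      dist (\<omega> + rescale k * gap) \<omega> < e \<and> \<omega> + rescale k * gap \<in> punctured_disc - Mset"
    using eventually_gap_mem_exterior by (rule eventually_conj)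
  then obtain k where "dist (\<omega> + rescale k * gap) \<omega> < e"
    "\<omega> + rescale k * gap \<in> punctured_disc - Mset"
    unfolding eventually_sequentially by blast
  then show "\<exists>z\<in>punctured_disc - Mset. z \<noteq> \<omega> \<and> dist z \<omega> < e"
    using mem_Mset by (metis DiffD2)
qed

definition ring_centre :: complex where
  "ring_centre = 1 / (1 - \<omega>) - ring_midpoint"

lemma cmod_ring_centre_le: "cmod ring_centre \<le> fixed 13800"
proof -
  have "cmod (grid 12157 6477) \<le> fixed 13776"
    by (subst cmod_le_iff) (simp_all add: grid_def fixed_def power2_eq_square)
  then show ?thesis using cmod_fixed_point_diff_le[of 49807 44761]
    by (simp add: ring_centre_def fixed_def)
qed

lemma eventually_ring_subset_interior:
  "\<forall>\<^sub>F k in sequentially. sphere (\<omega> + rescale k * ring_centre)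
     (cmod (rescale k) * fixed 22413) \<subseteq> interior Mset"
proof -
  have "0 < fixed 20" by (simp add: fixed_def)
  from eventually_tail_near[OF this] show ?thesis
  proof eventually_elim
    case (elim k)
    have "\<omega> + rescale k * u \<in> Mset" if u: "\<bar>cmod (u - ring_centre) - fixed 22413\<bar> < fixed 10" for u
    proof -
      define z where "z = \<omega> + rescale k * u"
      have "cmod u \<le> 1"
        using norm_triangle_sub[of u ring_centre] cmod_ring_centre_le u
        unfolding fixed_def by linarith
      then have z: "near_root z" "cmod (tail k z - (1 / (1 - \<omega>) - u)) < fixed 20"
        using elim by (simp_all add: z_def)
      have diff: "tail k z - ring_midpoint - (ring_centre - u) = tail k z - (1 / (1 - \<omega>) - u)"
        by (simp add: ring_centre_def)
      have "\<bar>cmod (tail k z - ring_midpoint) - cmod (u - ring_centre)\<bar> < fixed 20"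
        using norm_triangle_ineq3[of "tail k z - ring_midpoint" "ring_centre - u", unfolded diff]
          z(2) norm_minus_commute[of u ring_centre] by linarith
      then have "tail k z \<in> difference_set z"
        using u unfolding fixed_def
        by (intro mem_difference_set_annulus[OF z(1)]; unfold fixed_def; linarith)
      then show ?thesis unfolding z_def[symmetric] by (rule mem_Mset_if_tail[OF z(1)])
    qed
    then show ?case
      by (intro sphere_subset_interior_scaled[OF rescale_nonzero, of "fixed 10"])
        (simp add: fixed_def)
  qed
qed

lemma discs_nest_to_root:
  obtains a r where "discs_nest_to \<omega> a r" "\<And>n. sphere (a n) (r n) \<subseteq> interior Mset"
proof -
  obtain N where N: "\<And>k. N \<le> k \<Longrightarrow>
      sphere (\<omega> + rescale k * ring_centre) (cmod (rescale k) * fixed 22413) \<subseteq> interior Mset"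
    using eventually_ring_subset_interior unfolding eventually_sequentially by blast
  have "cmod ring_centre < fixed 22413" using cmod_ring_centre_le by (simp add: fixed_def)
  then obtain p where nest: "discs_nest_to \<omega> (\<lambda>n. \<omega> + rescale N * \<omega> ^ (p * n) * ring_centre)
      (\<lambda>n. cmod (rescale N * \<omega> ^ (p * n)) * fixed 22413)"
    using discs_nest_to_similar[OF rescale_nonzero nontrivial(1,2)] by blast
  have "rescale N * \<omega> ^ j = rescale (N + j)" for j
    by (simp add: rescale_eq[of N] rescale_eq[of "N + j"] power_add)
  then show ?thesis by (intro that[OF nest]) (simp only: N le_add1)
qed

lemma infinite_holes:
  assumes "0 < e"
  shows "infinite {H. hole H \<and> H \<subseteq> ball \<omega> e}"
proof -
  obtain a r where nest: "discs_nest_to \<omega> a r" and sphere: "\<And>n. sphere (a n) (r n) \<subseteq> interior Mset"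
    by (rule discs_nest_to_root) blast
  let ?e = "min e 0.1"
  have "hole H" if H: "H \<in> components (punctured_disc - Mset)" "H \<subseteq> ball \<omega> ?e" for H
  proof -
    have "1/4 \<notin> H"
      using H(2) near_root_norm(1)[OF near_root] norm_triangle_ineq2[of \<omega> "1/4"]
      by (auto simp: dist_norm)
    moreover have "1/4 \<in> {z :: complex. 0 < cmod z \<and> cmod z < 1/2}" by simp
    ultimately show ?thesis using H(1) unfolding hole_def by blast
  qed
  then have "{H \<in> components (punctured_disc - Mset). H \<subseteq> ball \<omega> ?e} \<subseteq> {H. hole H \<and> H \<subseteq> ball \<omega> e}"
    by auto
  moreover have "infinite {H \<in> components (punctured_disc - Mset). H \<subseteq> ball \<omega> ?e}"
    using sphere interior_subset mem_Mset assms
    by (intro infinite_components_if_discs_nest_to[OF nest _ islimpt_exterior]) (blast, simp_all)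
  ultimately show ?thesis using infinite_super by blast
qed

end

theorem theorem9p1p1:
  fixes \<omega> :: complex
  assumes root: "1 - 2*\<omega> + 2*\<omega>^2 - 2*\<omega>^5 + 2*\<omega>^8 = 0"
    and approx: "cmod (\<omega> - Complex 0.371859 0.519411) < 0.00001"
  shows "\<omega> \<in> Mset \<and> \<omega> \<in> M0 \<and> \<omega> \<in> M1
    \<and> ifs_f \<omega> ` Lambda \<omega> \<inter> ifs_g \<omega> ` Lambda \<omega> = {1/2}
    \<and> (\<forall>e>0. \<exists>z \<in> punctured_disc - Mset. cmod (z - \<omega>) < e)
    \<and> (\<exists>\<gamma> :: nat \<Rightarrow> real \<Rightarrow> complex.
         (\<forall>n. simple_path (\<gamma> n) \<and> pathfinish (\<gamma> n) = pathstart (\<gamma> n)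
              \<and> path_image (\<gamma> n) \<subseteq> interior Mset
              \<and> \<omega> \<notin> path_image (\<gamma> n)
              \<and> winding_number (\<gamma> n) \<omega> \<noteq> 0
              \<and> (\<forall>w \<in> path_image (\<gamma> (Suc n)).
                    w \<notin> path_image (\<gamma> n) \<and> winding_number (\<gamma> n) w \<noteq> 0))
         \<and> (\<forall>e>0. \<exists>N. \<forall>n\<ge>N. path_image (\<gamma> n) \<subseteq> ball \<omega> e))
    \<and> infinite {H. hole H}
    \<and> (\<forall>e>0. \<exists>H. hole H \<and> H \<inter> ball \<omega> e \<noteq> {})"
proof -
  interpret landmark_root \<omega>
    using root approx by unfold_locales (simp_all add: root_poly_def)
  obtain a r where "discs_nest_to \<omega> a r" "\<And>n. sphere (a n) (r n) \<subseteq> interior Mset"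
    by (rule discs_nest_to_root) blast
  note rings = circlepaths_if_discs_nest_to[OF this]
  have exterior: "\<forall>e>0. \<exists>z \<in> punctured_disc - Mset. cmod (z - \<omega>) < e"
    using islimpt_exterior unfolding islimpt_approachable dist_norm by blast
  have "infinite {H. hole H}"
    by (rule infinite_super[OF _ infinite_holes[of 1]]) auto
  moreover have "\<exists>H. hole H \<and> H \<inter> ball \<omega> e \<noteq> {}" if e_pos: "0 < e" for e
  proof -
    obtain H where "hole H" "H \<subseteq> ball \<omega> e"
      using infinite_imp_nonempty[OF infinite_holes[OF e_pos]] by blast
    moreover from this have "H \<noteq> {}" using in_components_nonempty by (auto simp: hole_def)
    ultimately show ?thesis by blast
  qed
  ultimately show ?thesis
    using mem_Mset mem_M0 mem_M1 ifs_images_meet exterior rings by blast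
qed

end
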